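(* There are infinitely many explicit quadratic irrational slopes $\alpha$ such that every billiard trajectory in the $\infty$-L-strip region starting from a corner and having initial slope $\alpha$ exhibits time-quantitative density: there is a constant $\beta=\beta(\alpha)>0$ such that for every unit square face $S$ of the region there is a constant $c_0=c_0(S;\alpha)$ such that for every integer $n\ge c_0$ and every point $Q\in S$, the initial segment of length $n^{\beta}$ of the trajectory comes within distance $1/n$ of $Q$.
   Context: The $\infty$-L-strip region is the infinite planar region $(\mathbb{R}\times[0,1])\cup\bigcup_{i\in\mathbb{Z}}([2i,2i+1]\times[1,2])$, i.e. a doubly infinite horizontal strip of unit squares with a unit square attached on top of every second square, so that it is a doubly infinite concatenation of L-shapes made of three unit squares. Its boundary acts as a mirror: a point billiard moves at unit speed along straight lines and reflects off the boundary with angle of incidence equal to angle of reflection. A corner means a vertex of one of the unit squares. *)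

theory Defs
  imports "HOL-Analysis.Analysis"
begin

definition quadratic_irrational :: "real \<Rightarrow> bool" where
  "quadratic_irrational x \<longleftrightarrow>
     x \<notin> \<rat> \<and> (\<exists>a b c :: int. a \<noteq> 0 \<and> of_int a * x^2 + of_int b * x + of_int c = 0)"

definition L_strip :: "(real \<times> real) set" where
  "L_strip = UNIV \<times> {0..1} \<union> (\<Union>i::int. {2 * of_int i..2 * of_int i + 1} \<times> {1..2})"

definition L_strip_square_origins :: "(int \<times> int) set" where
  "L_strip_square_origins = {(k, 0) | k. True} \<union> {(2 * i, 1) | i. True}"

definition unit_square :: "int \<times> int \<Rightarrow> (real \<times> real) set" where
  "unit_square = (\<lambda>(a, b). {of_int a..of_int a + 1} \<times> {of_int b..of_int b + 1})"

definition square_vertices :: "int \<times> int \<Rightarrow> (real \<times> real) set" where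
  "square_vertices = (\<lambda>(a, b). {of_int a, of_int a + 1} \<times> {of_int b, of_int b + 1})"

definition L_strip_faces :: "(real \<times> real) set set" where
  "L_strip_faces = unit_square ` L_strip_square_origins"

definition L_strip_corners :: "(real \<times> real) set" where
  "L_strip_corners = (\<Union>q \<in> L_strip_square_origins. square_vertices q)"

lemma L_strip_eq_Union_faces: "L_strip = \<Union> L_strip_faces"
proof (intro equalityI subsetI)
  fix p assume "p \<in> L_strip"
  moreover obtain x y where p: "p = (x, y)" by (cases p)
  ultimately consider "y \<in> {0..1}"
    | i :: int where "x \<in> {2 * of_int i..2 * of_int i + 1}" "y \<in> {1..2}"
    by (auto simp: L_strip_def)
  then show "p \<in> \<Union> L_strip_faces"
  proof cases
    case 1
    then have "p \<in> unit_square (\<lfloor>x\<rfloor>, 0)"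
      by (auto simp: p unit_square_def)
    then show ?thesis by (auto simp: L_strip_faces_def L_strip_square_origins_def)
  next
    case 2
    then have "p \<in> unit_square (2 * i, 1)" by (auto simp: p unit_square_def)
    then show ?thesis by (auto simp: L_strip_faces_def L_strip_square_origins_def)
  qed
next
  fix p assume "p \<in> \<Union> L_strip_faces"
  then show "p \<in> L_strip"
    by (auto simp: L_strip_faces_def L_strip_square_origins_def unit_square_def L_strip_def)
qed

text \<open>Near \<open>p\<close> the table \<open>R\<close> is a half-plane with inner unit normal \<open>\<nu>\<close> and \<open>p\<close> on its edge.\<close>

definition flat_boundary_point ::
    "(real \<times> real) set \<Rightarrow> real \<times> real \<Rightarrow> real \<times> real \<Rightarrow> bool" where
  "flat_boundary_point R p \<nu> \<longleftrightarrow>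
     norm \<nu> = 1 \<and> (\<exists>\<epsilon>>0. R \<inter> ball p \<epsilon> = {x \<in> ball p \<epsilon>. \<nu> \<bullet> (x - p) \<ge> 0})"

text \<open>
  Passing from incoming velocity \<open>u\<close> to outgoing velocity \<open>w\<close> at \<open>p\<close>: straight on in the
  interior, mirror image in the boundary line at a flat boundary point. At every other boundary
  point (for the L-strip these are the convex and reentrant vertices of the region) no
  continuation is allowed. Vertices of unit squares lying in the middle of a straight piece of
  the boundary, such as those on the bottom line, are flat boundary points.
\<close>

definition billiard_law ::
    "(real \<times> real) set \<Rightarrow> real \<times> real \<Rightarrow> real \<times> real \<Rightarrow> real \<times> real \<Rightarrow> bool" where
  "billiard_law R p u w \<longleftrightarrow>
     p \<in> interior R \<and> w = u \<or>
     (\<exists>\<nu>. flat_boundary_point R p \<nu> \<and> w = u - (2 * (u \<bullet> \<nu>)) *\<^sub>R \<nu>)"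

definition arrives_with :: "(real \<Rightarrow> real \<times> real) \<Rightarrow> real \<Rightarrow> real \<times> real \<Rightarrow> bool" where
  "arrives_with \<gamma> t u \<longleftrightarrow>
     norm u = 1 \<and> (\<exists>\<epsilon>>0. \<forall>s\<in>{0..\<epsilon>}. \<gamma> (t - s) = \<gamma> t - s *\<^sub>R u)"

definition departs_with :: "(real \<Rightarrow> real \<times> real) \<Rightarrow> real \<Rightarrow> real \<times> real \<Rightarrow> bool" where
  "departs_with \<gamma> t w \<longleftrightarrow>
     norm w = 1 \<and> (\<exists>\<epsilon>>0. \<forall>s\<in>{0..\<epsilon>}. \<gamma> (t + s) = \<gamma> t + s *\<^sub>R w)"

text \<open>
  A half-infinite unit-speed trajectory; only the values \<open>\<gamma> t\<close> with \<open>t \<ge> 0\<close> matter. The starting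
  point \<open>\<gamma> 0\<close> may be any point of the table, in particular a vertex. By unit speed, the initial
  segment of length \<open>T\<close> is the image of \<open>{0..T}\<close>.
\<close>

definition billiard_trajectory :: "(real \<times> real) set \<Rightarrow> (real \<Rightarrow> real \<times> real) \<Rightarrow> bool" where
  "billiard_trajectory R \<gamma> \<longleftrightarrow>
     (\<forall>t\<ge>0. \<gamma> t \<in> R) \<and>
     (\<exists>w. departs_with \<gamma> 0 w) \<and>
     (\<forall>t>0. \<exists>u w. arrives_with \<gamma> t u \<and> departs_with \<gamma> t w \<and> billiard_law R (\<gamma> t) u w)"

definition initial_slope :: "(real \<Rightarrow> real \<times> real) \<Rightarrow> real \<Rightarrow> bool" where
  "initial_slope \<gamma> \<alpha> \<longleftrightarrow>
     (\<exists>w. departs_with \<gamma> 0 w \<and> fst w \<noteq> 0 \<and> snd w / fst w = \<alpha>)"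

end

theory Submission
  imports Defs
begin

text \<open>
  Cut an unfolding of the region along the horizontal line at height 1 into tiles of width 1 and
  height 2. A trajectory of slope \<open>\<alpha>\<close> passes this line at the points of an orbit of the rotation by
  \<open>\<omega> = 2 / \<alpha>\<close> on the circle, and the tile it enters changes by one of two permutations: up, of
  order 2, or right-then-up, all of whose cycles have length 6. For suitable quadratic irrational
  \<open>\<omega>\<close> the itinerary of the point 0 is fixed by a substitution \<open>U \<rightarrow> U D\<^sup>1\<^sup>2\<close>, \<open>D \<rightarrow> U\<^sup>q D\<close> (composed)
  which acts trivially on the tiles and contracts displacements by a factor \<open>\<kappa>\<close>. Applying the
  substitution to one letter read at a tile produces that letter at all tiles of a neighbouring
  6-cycle, so after \<open>m\<close> substitutions it has been read everywhere up to distance \<open>m\<close>, within time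
  exponential in \<open>m\<close>. As a prefix of the \<open>K\<close>-fold substitution moves tiles by \<open>O(K)\<close> only, any
  prescribed tile can be hit at any prescribed point up to an error \<open>O(\<kappa>\<^sup>K)\<close>, again in time
  exponential in \<open>K\<close>.
\<close>

section \<open>Tiles, words and the substitution\<close>

text \<open>The state space is a circle times infinitely many tiles, so compactness and
  equidistribution on the circle do not tell when a given tile is visited. Tile and circle point
  must be controlled together. This works because the substitution keeps the action of a word on
  tiles exactly while multiplying its weight by \<open>\<kappa>\<close>: a word that corrects the
  tile can be substituted until the displacement it causes is negligible.

  Two demands fix the constants. The action is kept if the exponent of \<open>U\<close> is even and
  that of \<open>D\<close> a multiple of 6. Self-similarity of the rotation asks for
  \<open>d - q * u = \<kappa> * d\<close> and \<open>u - 12 * (\<kappa> * d) = \<kappa> * u\<close>.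
  With \<open>d = \<tau> * u\<close> this amounts to
  \<open>\<tau>\<^sup>2 = q * \<tau> + q / 12\<close>, and \<open>q = 12 * c\<close> makes the
  coefficients integral and \<open>q\<close> even. Each \<open>c > 0\<close> gives one slope.

  The exponent depends on the slope alone because the distance to the wanted tile enters the number
  of substitutions additively, hence the time only as a constant factor, which the threshold for
  \<open>n\<close> absorbs.\<close>

text \<open>
  A trajectory is cut at its passages through the line at height 1. \<open>Even i\<close> and \<open>Odd i\<close> are the
  squares \<open>(2 i, 0)\<close> and \<open>(2 i + 1, 0)\<close>, traversed down and up again; \<open>Top i\<close> is the square
  \<open>(2 i, 1)\<close>, traversed up and down again. The flag tells whether the horizontal velocity is
  positive. \<open>tile_right\<close> and \<open>tile_up\<close> are the neighbours in the unfolding.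
\<close>

datatype tile = Even int bool | Odd int bool | Top int bool

fun tile_right :: "tile \<Rightarrow> tile" where
  "tile_right (Even i \<sigma>) = Odd (if \<sigma> then i else i - 1) \<sigma>"
| "tile_right (Odd i \<sigma>) = Even (if \<sigma> then i + 1 else i) \<sigma>"
| "tile_right (Top i \<sigma>) = Top i (\<not> \<sigma>)"

fun tile_up :: "tile \<Rightarrow> tile" where
  "tile_up (Even i \<sigma>) = Top i \<sigma>"
| "tile_up (Odd i \<sigma>) = Odd i \<sigma>"
| "tile_up (Top i \<sigma>) = Even i \<sigma>"

text \<open>The flag \<open>x\<close> says that the rotation wraps past 1, that is, that the flight
  has crossed the right edge of the tile when it returns to height 1.\<close>

definition move :: "bool \<Rightarrow> tile \<Rightarrow> tile" where
  "move x s = tile_up (if x then tile_right s else s)"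

definition act :: "bool list \<Rightarrow> tile \<Rightarrow> tile" where
  "act = fold move"

definition step :: "real \<Rightarrow> real \<times> tile \<Rightarrow> real \<times> tile" where
  "step \<omega> = (\<lambda>(z, s). if z + \<omega> < 1 then (z + \<omega>, move False s) else (z + \<omega> - 1, move True s))"

text \<open>The fibres of \<open>cyc\<close> are the 6-cycles of the diagonal move, numbered from left to right.\<close>

fun cyc :: "tile \<Rightarrow> int" where
  "cyc (Even i \<sigma>) = (if \<sigma> then i else i - 1)"
| "cyc (Odd i \<sigma>) = i"
| "cyc (Top i \<sigma>) = (if \<sigma> then i - 1 else i)"

lemma act_simps [simp]:
  "act [] s = s" "act (x # w) s = act w (move x s)" "act (v @ w) s = act w (act v s)"
  by (simp_all add: act_def)

lemma move_up_up [simp]: "move False (move False s) = s"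
  by (cases s) (auto simp: move_def)

lemma move_diag_6 [simp]: "(move True ^^ 6) s = s"
  by (cases s) (auto simp: move_def numeral_eq_Suc)

lemma cyc_move_diag [simp]: "cyc (move True s) = cyc s"
  by (cases s) (auto simp: move_def)

lemma cyc_move: "\<bar>cyc (move x s) - cyc s\<bar> \<le> 1"
  by (cases s; cases x) (auto simp: move_def)

lemma cyc_act: "\<bar>cyc (act w s) - cyc s\<bar> \<le> int (length w)"
proof (induction w arbitrary: s)
  case (Cons x w)
  show ?case using Cons[of "move x s"] cyc_move[of x s] by simp
qed simp

lemma tile_cases:
  obtains i where "s = Even i True" | i where "s = Even i False" | i where "s = Odd i True"
    | i where "s = Odd i False" | i where "s = Top i True" | i where "s = Top i False"
  by (metis (full_types) tile.exhaust)

text \<open>The cycle numbered \<open>i\<close> is \<open>Even i True\<close>,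
  \<open>Odd i True\<close>, \<open>Top (i + 1) True\<close>, \<open>Even (i + 1) False\<close>,
  \<open>Odd i False\<close>, \<open>Top i False\<close>, and back to the start.\<close>

lemma diag_orbit_eq_cyc:
  assumes "cyc s = cyc t"
  shows "\<exists>n<6. (move True ^^ n) s = t"
proof -
  let ?d = "move True"
  consider "s = t" | "?d s = t" | "?d (?d s) = t" | "?d (?d (?d s)) = t"
    | "?d (?d (?d (?d s))) = t" | "?d (?d (?d (?d (?d s)))) = t"
    using assms by (cases s rule: tile_cases; cases t rule: tile_cases) (auto simp: move_def)
  then show ?thesis
  proof cases
    case 1 then show ?thesis by (intro exI[of _ 0]) simp
  next
    case 2 then show ?thesis by (intro exI[of _ 1]) simp
  next
    case 3 then show ?thesis by (intro exI[of _ 2]) (simp add: numeral_eq_Suc)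
  next
    case 4 then show ?thesis by (intro exI[of _ 3]) (simp add: numeral_eq_Suc)
  next
    case 5 then show ?thesis by (intro exI[of _ 4]) (simp add: numeral_eq_Suc)
  next
    case 6 then show ?thesis by (intro exI[of _ 5]) (simp add: numeral_eq_Suc)
  qed
qed

lemma surj_move: "\<exists>t. move x t = s"
proof (cases x)
  case True
  have "move True ((move True ^^ 5) s) = s"
    using move_diag_6[of s] by (simp add: numeral_eq_Suc)
  then show ?thesis using True by (intro exI) simp
next
  case False
  then show ?thesis by (intro exI[of _ "move False s"]) simp
qed

lemma surj_act: "\<exists>t. act w t = s"
proof (induction w arbitrary: s)
  case (Cons x w)
  then show ?case using surj_move act_simps(2) by metis
qed simp

lemma act_replicate: "act (replicate n x) s = (move x ^^ n) s"
  by (induction n arbitrary: s) (simp_all add: funpow_swap1)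

lemma act_replicate_up: "even n \<Longrightarrow> act (replicate n False) s = s"
proof (elim evenE)
  fix m assume "n = 2 * m"
  moreover have "act (replicate (2 * m) False) s = s"
    by (induction m) simp_all
  ultimately show ?thesis by simp
qed


section \<open>Substitutions on words\<close>

definition sub_word :: "(bool \<Rightarrow> bool list) \<Rightarrow> bool list \<Rightarrow> bool list" where
  "sub_word g w = concat (map g w)"

lemma sub_word_simps [simp]:
  "sub_word g [] = []" "sub_word g (x # w) = g x @ sub_word g w"
  "sub_word g (v @ w) = sub_word g v @ sub_word g w"
  by (simp_all add: sub_word_def)

lemma funpow_sub_word_append:
  "(sub_word g ^^ k) (v @ w) = (sub_word g ^^ k) v @ (sub_word g ^^ k) w"
  by (induction k) simp_all

lemma act_sub_word:
  assumes "\<And>x s. act (g x) s = move x s"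
  shows "act (sub_word g w) s = act w s"
  by (induction w arbitrary: s) (simp_all add: assms)

lemma act_funpow_sub_word:
  assumes "\<And>x s. act (g x) s = move x s"
  shows "act ((sub_word g ^^ k) w) s = act w s"
  by (induction k) (simp_all add: act_sub_word[of g, OF assms])

lemma length_sub_word_le:
  assumes "\<And>x. length (g x) \<le> L"
  shows "length (sub_word g w) \<le> L * length w"
proof (induction w)
  case (Cons x w)
  then show ?case using assms[of x] by simp
qed simp

lemma length_funpow_sub_word_le:
  assumes "\<And>x. length (g x) \<le> L"
  shows "length ((sub_word g ^^ k) w) \<le> L ^ k * length w"
proof (induction k)
  case (Suc k)
  have "length (sub_word g ((sub_word g ^^ k) w)) \<le> L * length ((sub_word g ^^ k) w)"
    by (rule length_sub_word_le[OF assms])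
  also have "\<dots> \<le> L * (L ^ k * length w)" using Suc by simp
  finally show ?case by (simp add: mult.assoc)
qed simp

lemma length_sub_word_ge:
  assumes "\<And>x. length (g x) \<ge> m"
  shows "length (sub_word g w) \<ge> m * length w"
proof (induction w)
  case (Cons x w)
  then show ?case using assms[of x] by simp
qed simp

lemma length_funpow_sub_word_ge:
  assumes "\<And>x. length (g x) \<ge> m"
  shows "length ((sub_word g ^^ k) w) \<ge> m ^ k * length w"
proof (induction k)
  case (Suc k)
  have "m * (m ^ k * length w) \<le> m * length ((sub_word g ^^ k) w)" using Suc by simp
  also have "\<dots> \<le> length (sub_word g ((sub_word g ^^ k) w))"
    by (rule length_sub_word_ge[OF assms])
  finally show ?case by (simp add: mult.assoc)
qed simp

text \<open>The cut falls inside or at the end of the image of one letter: \<open>b\<close> collects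
  the letters with complete images, \<open>a'\<close> is the remainder.\<close>

lemma prefix_sub_word:
  assumes "\<And>x. length (g x) \<le> L" and "sub_word g w = a @ r"
  shows "\<exists>b b' a'. w = b @ b' \<and> a = sub_word g b @ a' \<and> length a' \<le> L"
  using assms(2)
proof (induction w arbitrary: a)
  case (Cons x w)
  from Cons.prems have "g x @ sub_word g w = a @ r" by simp
  then consider us where "a = g x @ us" "sub_word g w = us @ r" | us where "g x = a @ us"
    by (auto simp: append_eq_append_conv2)
  then show ?case
  proof cases
    case 1
    from Cons.IH[OF 1(2)] obtain b b' a' where "w = b @ b'" "us = sub_word g b @ a'" "length a' \<le> L"
      by blast
    then show ?thesis using 1(1)
      by (intro exI[of _ "x # b"] exI[of _ b'] exI[of _ a']) simp
  next
    case 2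
    then show ?thesis using assms(1)[of x]
      by (intro exI[of _ "[]"] exI[of _ "x # w"] exI[of _ a]) simp
  qed
qed auto

text \<open>Desubstitution: up to a tail of at most \<open>L\<close> letters, a prefix is the image
  of a prefix one level lower, which acts in the same way. So each level costs at most
  \<open>L\<close>, although the prefix itself may be exponentially long in
  \<open>k\<close>.\<close>

lemma cyc_act_prefix:
  assumes "\<And>x s. act (g x) s = move x s" and "\<And>x. length (g x) \<le> L"
    and "(sub_word g ^^ k) [x] = a @ r"
  shows "\<bar>cyc (act a s) - cyc s\<bar> \<le> int (L * k + 1)"
  using assms(3)
proof (induction k arbitrary: a r)
  case 0
  then have "length a \<le> 1" by (cases a) auto
  with cyc_act[of a s] show ?case by simp
next
  case (Suc k)
  then have "sub_word g ((sub_word g ^^ k) [x]) = a @ r" by simp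
  from prefix_sub_word[of g L, OF assms(2) this] obtain b b' a'
    where b: "(sub_word g ^^ k) [x] = b @ b'" "a = sub_word g b @ a'" "length a' \<le> L"
    by blast
  have "act a s = act a' (act b s)"
    by (simp add: b(2) act_sub_word[of g, OF assms(1)])
  moreover have "\<bar>cyc (act b s) - cyc s\<bar> \<le> int (L * k + 1)"
    by (rule Suc.IH[OF b(1)])
  moreover have "\<bar>cyc (act a' (act b s)) - cyc (act b s)\<bar> \<le> int L"
    using cyc_act[of a' "act b s"] b(3) by simp
  ultimately show ?case by simp
qed

text \<open>A letter \<open>False\<close> read at \<open>t\<close> unfolds under \<open>K\<close>
  further substitutions into a full copy of the \<open>K\<close>-fold image of
  \<open>[False]\<close> started at \<open>t\<close>. That copy is what gets used later.\<close>

definition up_occurs :: "bool list \<Rightarrow> tile \<Rightarrow> tile \<Rightarrow> bool" where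
  "up_occurs w s t \<longleftrightarrow> (\<exists>b r. w = b @ [False] @ r \<and> act b s = t)"

lemma up_occurs_appendI1: "up_occurs v s t \<Longrightarrow> up_occurs (v @ w) s t"
  unfolding up_occurs_def by (metis append.assoc)

lemma up_occurs_appendI2: "up_occurs w (act v s) t \<Longrightarrow> up_occurs (v @ w) s t"
  unfolding up_occurs_def by (metis append.assoc act_simps(3))

lemma up_occurs_Cons: "up_occurs (False # w) s s"
  unfolding up_occurs_def by (rule exI[of _ "[]"]) simp

definition diag_block :: "nat \<Rightarrow> bool list" where
  "diag_block q = replicate q False @ [True]"

text \<open>The two factors are kept apart because legality is transferred through one at a time;
  \<open>letter_image\<close> gives their composition.\<close>

definition subD :: "bool list \<Rightarrow> bool list" where
  "subD = sub_word (\<lambda>x. if x then [True] else False # replicate 12 True)"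

definition subG :: "nat \<Rightarrow> bool list \<Rightarrow> bool list" where
  "subG q = sub_word (\<lambda>x. if x then diag_block q else [False])"

definition letter_image :: "nat \<Rightarrow> bool \<Rightarrow> bool list" where
  "letter_image q x = (if x then diag_block q else False # concat (replicate 12 (diag_block q)))"

abbreviation subst :: "nat \<Rightarrow> bool list \<Rightarrow> bool list" where
  "subst q \<equiv> sub_word (letter_image q)"

lemma subG_replicate_True: "subG q (replicate n True) = concat (replicate n (diag_block q))"
  by (induction n) (simp_all add: subG_def)

lemma subst_eq: "subst q w = subG q (subD w)"
proof (induction w)
  case Nil
  show ?case by (simp add: subG_def subD_def)
next
  case (Cons x w)
  have "subG q (subD (x # w)) = letter_image q x @ subG q (subD w)"
    using subG_replicate_True[of q 12]
    by (simp add: subD_def letter_image_def) (simp add: subG_def)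
  with Cons show ?case by simp
qed

lemma act_diag_block [simp]: "even q \<Longrightarrow> act (diag_block q) s = move True s"
  by (simp add: diag_block_def act_replicate_up)

lemma act_diag_blocks:
  "even q \<Longrightarrow> act (concat (replicate n (diag_block q))) s = (move True ^^ n) s"
  by (induction n arbitrary: s) (simp_all add: funpow_swap1)

lemma move_diag_12 [simp]: "(move True ^^ 12) s = s"
  using move_diag_6 funpow_add[of 6 6 "move True"] by simp

lemma act_letter_image: "even q \<Longrightarrow> act (letter_image q x) s = move x s"
  by (simp add: letter_image_def act_diag_blocks)

lemma length_diag_blocks: "length (concat (replicate n (diag_block q))) = n * (q + 1)"
  by (induction n) (simp_all add: diag_block_def)

lemma length_letter_image_le: "length (letter_image q x) \<le> 13 * (q + 1)"
  by (simp add: letter_image_def length_diag_blocks) (simp add: diag_block_def)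

lemma length_letter_image_ge: "q > 0 \<Longrightarrow> length (letter_image q x) \<ge> 2"
  by (simp add: letter_image_def length_diag_blocks) (simp add: diag_block_def)

text \<open>The blocks after the leading \<open>False\<close> act as diagonal moves, so the twelve
  block starts run twice through the 6-cycle of \<open>move False s\<close>, and for
  \<open>q > 0\<close> every block opens with \<open>False\<close>.\<close>

lemma up_occurs_letter_image:
  assumes "even q" "q > 0" "cyc t = cyc (move False s)"
  shows "up_occurs (letter_image q False) s t"
proof -
  from diag_orbit_eq_cyc[of "move False s" t] assms(3)
  obtain n where n: "n < 6" "(move True ^^ n) (move False s) = t" by auto
  have "up_occurs (diag_block q) t t"
    using \<open>q > 0\<close> by (cases q) (simp_all add: diag_block_def up_occurs_Cons)
  moreover have "letter_image q False =
      (False # concat (replicate n (diag_block q))) @ diag_block q @ concat (replicate (11 - n) (diag_block q))"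
  proof -
    have "replicate 12 (diag_block q) = replicate n (diag_block q) @ replicate (Suc (11 - n)) (diag_block q)"
      using n(1) by (simp only: replicate_add[symmetric]) simp
    then show ?thesis by (simp add: letter_image_def del: replicate.simps) simp
  qed
  ultimately show ?thesis
    using n(2) assms(1)
    by (simp only:) (intro up_occurs_appendI2 up_occurs_appendI1, simp add: act_diag_blocks)
qed

lemma up_occurs_subst:
  assumes "even q" "q > 0" "up_occurs w s t'" "cyc t = cyc (move False t')"
  shows "up_occurs (subst q w) s t"
proof -
  from assms(3) obtain b r where w: "w = b @ [False] @ r" "act b s = t'"
    unfolding up_occurs_def by blast
  have "up_occurs (letter_image q False) (act (subst q b) s) t"
    using up_occurs_letter_image assms(1,2,4) w(2)
    by (simp add: act_sub_word[of "letter_image q", OF act_letter_image])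
  then show ?thesis unfolding w(1)
    by (simp add: up_occurs_appendI1 up_occurs_appendI2)
qed

text \<open>Diagonal moves never leave a cycle, so only up moves can; these are the exits used to
  spread from cycle to cycle.\<close>

lemma ex_cyc_move_up:
  assumes "\<bar>e\<bar> \<le> 1"
  shows "\<exists>t. cyc t = i \<and> cyc (move False t) = i + e"
proof -
  consider "e = 0" | "e = 1" | "e = -1" using assms by linarith
  then show ?thesis
  proof cases
    case 1 then show ?thesis by (intro exI[of _ "Odd i True"]) (simp add: move_def)
  next
    case 2 then show ?thesis by (intro exI[of _ "Top (i + 1) True"]) (simp add: move_def)
  next
    case 3 then show ?thesis by (intro exI[of _ "Top i False"]) (simp add: move_def)
  qed
qed

lemma up_occurs_funpow_subst:
  assumes "even q" "q > 0" "\<bar>cyc t - cyc (move False s)\<bar> \<le> int m"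
  shows "up_occurs ((subst q ^^ Suc m) [False]) s t"
  using assms(3)
proof (induction m arbitrary: t)
  case 0
  then show ?case using up_occurs_letter_image assms(1,2) by simp
next
  case (Suc m)
  \<comment> \<open>The direction from the cycle already reached towards that of \<open>t\<close>.
    If they coincide, \<open>e = 0\<close> selects an up move that stays inside the cycle.\<close>
  define e where "e = (if cyc t > cyc (move False s) then 1 else if cyc t < cyc (move False s) then - 1 else (0::int))"
  have "\<bar>e\<bar> \<le> 1" by (simp add: e_def)
  from ex_cyc_move_up[OF this, of "cyc t - e"]
  obtain t' where t': "cyc t' = cyc t - e" "cyc (move False t') = cyc t" by auto
  have "\<bar>cyc t' - cyc (move False s)\<bar> \<le> int m"
    using Suc.prems t'(1) by (auto simp: e_def)
  from up_occurs_subst[OF assms(1,2) Suc.IH[OF this], of t] t'(2)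
  show ?case by simp
qed

section \<open>Renormalization of the rotation\<close>

text \<open>
  A letter \<open>False\<close> displaces by \<open>u\<close> and a letter \<open>True\<close> by \<open>- d\<close>. With \<open>u + d = 1\<close>, the word
  \<open>w\<close> is an itinerary of the rotation by \<open>u\<close> started at \<open>f\<close> iff all partial sums stay in
  \<open>{0..<u + d}\<close>; admitting other \<open>u\<close> and \<open>d\<close> makes this condition scale with the substitution.
\<close>

definition wt :: "real \<Rightarrow> real \<Rightarrow> bool list \<Rightarrow> real" where
  "wt u d w = (\<Sum>x\<leftarrow>w. if x then - d else u)"

lemma wt_simps [simp]:
  "wt u d [] = 0" "wt u d (x # w) = (if x then - d else u) + wt u d w"
  "wt u d (v @ w) = wt u d v + wt u d w"
  by (simp_all add: wt_def)

fun legal :: "real \<Rightarrow> real \<Rightarrow> real \<Rightarrow> bool list \<Rightarrow> bool" where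
  "legal u d f [] \<longleftrightarrow> 0 \<le> f \<and> f < u + d"
| "legal u d f (x # w) \<longleftrightarrow> 0 \<le> f \<and> f < u + d \<and> legal u d (f + (if x then - d else u)) w"

lemma legal_bounds: "legal u d f w \<Longrightarrow> 0 \<le> f \<and> f < u + d"
  by (cases w) auto

lemma legal_append: "legal u d f (v @ w) \<longleftrightarrow> legal u d f v \<and> legal u d (f + wt u d v) w"
proof (induction v arbitrary: f)
  case Nil
  then show ?case using legal_bounds by auto
next
  case (Cons x v)
  then show ?case by (auto simp: algebra_simps)
qed

lemma legal_wt: "legal u d f w \<Longrightarrow> 0 \<le> f + wt u d w \<and> f + wt u d w < u + d"
  using legal_append[of u d f w "[]"] by simp

lemma legal_scale: "c > 0 \<Longrightarrow> legal (c * u) (c * d) (c * f) w \<longleftrightarrow> legal u d f w"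
proof (induction w arbitrary: f)
  case Nil
  then show ?case by (simp add: zero_le_mult_iff distrib_left[symmetric])
next
  case (Cons x w)
  have "c * f + (if x then - (c * d) else c * u) = c * (f + (if x then - d else u))"
    by (simp add: algebra_simps)
  with Cons show ?case by (simp add: zero_le_mult_iff distrib_left[symmetric])
qed

lemma wt_scale: "wt (c * u) (c * d) w = c * wt u d w"
  by (induction w) (simp_all add: algebra_simps)

lemma wt_sub_word:
  assumes "\<And>x. wt u d (g x) = (if x then - d' else u')"
  shows "wt u d (sub_word g w) = wt u' d' w"
  by (induction w) (simp_all add: assms)

lemma legal_ups:
  assumes "u \<ge> 0" "d > 0" "0 \<le> f" "f + real n * u < u + d"
  shows "legal u d f (replicate n False)"
  using assms(3,4)
proof (induction n arbitrary: f)
  case (Suc n)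
  then have *: "f + u + real n * u < u + d" by (simp add: algebra_simps)
  have "0 \<le> real n * u" using \<open>u \<ge> 0\<close> by simp
  then have "f < u + d" using * \<open>u \<ge> 0\<close> by linarith
  then show ?case using Suc.IH[of "f + u"] * Suc.prems \<open>u \<ge> 0\<close> by simp
qed simp

lemma legal_diags:
  assumes "u \<ge> 0" "d > 0" "f < u + d" "f - real n * d \<ge> 0"
  shows "legal u d f (replicate n True)"
  using assms(3,4)
proof (induction n arbitrary: f)
  case (Suc n)
  then have *: "f - d - real n * d \<ge> 0" by (simp add: algebra_simps)
  have "0 \<le> real n * d" using \<open>d > 0\<close> by simp
  then have "f \<ge> 0" using * \<open>d > 0\<close> by linarith
  then show ?case using Suc.IH[of "f - d"] * Suc.prems \<open>d > 0\<close> by simp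
qed simp

lemma wt_replicate: "wt u d (replicate n x) = real n * (if x then - d else u)"
  by (induction n) (simp_all add: algebra_simps)

text \<open>A coarse drop by \<open>d - q * u\<close> is carried out as \<open>q\<close> rises and
  one drop by \<open>d\<close>. Starting below \<open>u + d - q * u\<close>, the rises stay below
  \<open>u + d\<close>, and the drop lands on the coarse value.\<close>

lemma legal_subG:
  assumes "u > 0" "d - real q * u > 0" "legal u (d - real q * u) f w"
  shows "legal u d f (subG q w)"
  using assms(3)
proof (induction w arbitrary: f)
  case Nil
  have "real q * u \<ge> 0" using assms(1) by simp
  with Nil show ?case by (simp add: subG_def)
next
  case (Cons x w)
  have qu: "real q * u \<ge> 0" using assms(1) by simp
  have d: "d > 0" using qu assms(2) by linarith
  show ?case
  proof (cases x)
    case True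
    from Cons.prems True have f: "0 \<le> f" "f < u + (d - real q * u)"
      and l: "legal u (d - real q * u) (f - (d - real q * u)) w" by (auto simp: algebra_simps)
    have "legal u d f (replicate q False)"
      using f assms(1) d by (intro legal_ups) auto
    moreover have "legal u d (f + real q * u) [True]"
      using f qu d legal_bounds[OF l] by (simp add: mult.commute)
    moreover have "legal u d (f + real q * u - d) (subG q w)"
      using Cons.IH[OF l] by (simp add: algebra_simps)
    ultimately show ?thesis using True
      by (simp add: subG_def diag_block_def legal_append wt_replicate)
  next
    case False
    from Cons.prems False have f: "0 \<le> f" "f < u + (d - real q * u)"
      and l: "legal u (d - real q * u) (f + u) w" by auto
    show ?thesis using False Cons.IH[OF l] f qu by (simp add: subG_def)
  qed
qed

text \<open>A coarse rise by \<open>u - 12 * d\<close> is carried out as a rise by \<open>u\<close>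
  and twelve drops. Its endpoint lies in the coarse interval, which bounds the peak
  \<open>f + u\<close> by \<open>u + d\<close> and keeps the drops nonnegative.\<close>

lemma legal_subD:
  assumes "d > 0" "u - 12 * d > 0" "legal (u - 12 * d) d f w"
  shows "legal u d f (subD w)"
  using assms(3)
proof (induction w arbitrary: f)
  case Nil
  with assms(1) show ?case by (simp add: subD_def)
next
  case (Cons x w)
  show ?case
  proof (cases x)
    case True
    with Cons assms(1) show ?thesis by (simp add: subD_def)
  next
    case False
    with Cons.prems have f: "0 \<le> f" "f < u - 12 * d + d"
      and l: "legal (u - 12 * d) d (f + u - 12 * d) w" by (auto simp: algebra_simps)
    have f': "f + u < u + d" using legal_bounds[OF l] by simp
    have "legal u d (f + u) (replicate 12 True)"
      using f f' legal_bounds[OF l] assms(1,2) by (intro legal_diags) auto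
    moreover have "legal u d (f + u - 12 * d) (subD w)" using Cons.IH[OF l] .
    ultimately have "legal u d f (False # replicate 12 True @ subD w)"
      using f f' assms(1,2)
      by (simp add: legal_append wt_replicate algebra_simps del: replicate.simps)
    then show ?thesis using False by (simp add: subD_def)
  qed
qed

text \<open>Trajectories from the corners at heights 0 and 2 first meet height 1 at \<open>u / 2\<close>. That point is
  self-similar as well, up to a prefix acting trivially on the tiles; this is why the exponent is
  12 and not 6.\<close>

definition half_block :: "nat \<Rightarrow> bool list" where
  "half_block q = concat (replicate 6 (diag_block q))"

lemma legal_half_subD:
  assumes "d > 0" "u - 12 * d > 0" "legal (u - 12 * d) d ((u - 12 * d) / 2) w"
  shows "legal u d (u / 2) (replicate 6 True @ subD w)"
proof -
  have "legal u d (u / 2) (replicate 6 True)"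
    using assms by (intro legal_diags) auto
  moreover have "legal u d (u / 2 - 6 * d) (subD w)"
    using legal_subD[OF assms(1,2), of "u / 2 - 6 * d" w] assms(3)
    by (simp add: diff_divide_distrib)
  ultimately show ?thesis
    by (simp add: legal_append wt_replicate algebra_simps del: replicate.simps)
qed

section \<open>Slopes for which the rotation is self-similar\<close>

locale strip_slope =
  fixes c :: nat and \<tau> :: real
  assumes c_pos: "c > 0" and tau_pos: "\<tau> > 0" and tau_eq: "\<tau>\<^sup>2 = 12 * real c * \<tau> + real c"
begin

definition "q = 12 * c"
definition "u = 1 / (1 + \<tau>)"
definition "d = \<tau> / (1 + \<tau>)"
definition "\<kappa> = real c / \<tau>\<^sup>2"

lemma even_q: "even q" by (simp add: q_def)
lemma q_pos: "q > 0" using c_pos by (simp add: q_def)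

lemma tau_gt: "\<tau> > 12 * real c"
proof -
  have "\<tau> * \<tau> > 12 * real c * \<tau>" using tau_eq c_pos by (simp add: power2_eq_square)
  then show ?thesis using tau_pos by simp
qed

lemma u_pos: "u > 0" and d_pos: "d > 0" and u_add_d: "u + d = 1" and u_lt_1: "u < 1"
  using tau_pos by (auto simp: u_def d_def field_simps)

lemma kappa_pos: "\<kappa> > 0"
  using c_pos tau_pos by (simp add: \<kappa>_def)

lemma kappa_le: "\<kappa> \<le> 1 / 2"
proof -
  have "12 * real c * \<tau> \<ge> 12 * real c * 1"
    using tau_gt c_pos by (intro mult_left_mono) auto
  then have "\<tau>\<^sup>2 \<ge> 2 * real c" using tau_eq c_pos by simp
  then show ?thesis using tau_pos by (simp add: \<kappa>_def field_simps)
qed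

lemma d_eq: "d = \<tau> * u" by (simp add: d_def u_def)

lemma u_lt_d: "u < d"
proof -
  have "real c \<ge> 1" using c_pos by simp
  then have "\<tau> > 1" using tau_gt by linarith
  then show ?thesis using u_pos by (simp add: d_eq)
qed

lemma kappa_tau: "\<kappa> * \<tau> = real c / \<tau>"
  using tau_pos by (simp add: \<kappa>_def power2_eq_square)

lemma kappa_tau': "\<kappa> * \<tau> = \<tau> - 12 * real c"
  unfolding kappa_tau using tau_eq tau_pos by (simp add: field_simps power2_eq_square)

text \<open>With \<open>weight_u\<close>, the eigenvector equations: undoing \<open>subG\<close>
  turns the weights \<open>(u, d)\<close> into \<open>(u, \<kappa> * d)\<close>, and undoing
  \<open>subD\<close> turns these into \<open>(\<kappa> * u, \<kappa> * d)\<close>, a scaled copy of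
  the start.\<close>

lemma weight_d: "d - real q * u = \<kappa> * d"
proof -
  have "d - real q * u = (\<tau> - 12 * real c) * u" by (simp add: d_eq q_def algebra_simps)
  then show ?thesis by (simp add: kappa_tau'[symmetric] d_eq)
qed

lemma weight_u: "u - 12 * (\<kappa> * d) = \<kappa> * u"
proof -
  have "\<kappa> * \<tau> = \<tau> * (1 - 12 * (\<kappa> * \<tau>))"
  proof -
    have "\<tau> * (\<kappa> * \<tau>) = real c" unfolding kappa_tau using tau_pos by simp
    then have "\<tau> * (1 - 12 * (\<kappa> * \<tau>)) = \<tau> - 12 * real c" by (simp add: algebra_simps)
    then show ?thesis by (simp add: kappa_tau')
  qed
  then have "\<kappa> = 1 - 12 * (\<kappa> * \<tau>)" using tau_pos by simp
  then have "\<kappa> * u = (1 - 12 * (\<kappa> * \<tau>)) * u" by simp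
  then show ?thesis by (simp add: d_eq algebra_simps)
qed

lemma wt_subst: "wt u d (subst q w) = \<kappa> * wt u d w"
proof -
  have b: "wt u d (diag_block q) = - (\<kappa> * d)"
    using weight_d by (simp add: diag_block_def wt_replicate)
  have "wt u d (concat (replicate n (diag_block q))) = - (real n * (\<kappa> * d))" for n
    by (induction n) (simp_all add: b algebra_simps)
  from this[of 12] have "wt u d (letter_image q x) = (if x then - (\<kappa> * d) else \<kappa> * u)" for x
    using b weight_u by (simp add: letter_image_def)
  from wt_sub_word[OF this] show ?thesis by (simp add: wt_scale)
qed

lemma wt_funpow_subst: "wt u d ((subst q ^^ k) w) = \<kappa> ^ k * wt u d w"
  by (induction k) (simp_all add: wt_subst)

lemma legal_subst:
  assumes "legal u d f w"
  shows "legal u d (\<kappa> * f) (subst q w)"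
proof -
  have "legal (u - 12 * (\<kappa> * d)) (\<kappa> * d) (\<kappa> * f) w"
    using assms kappa_pos by (simp add: weight_u legal_scale)
  then have "legal u (\<kappa> * d) (\<kappa> * f) (subD w)"
    using kappa_pos d_pos u_pos by (intro legal_subD) (simp_all add: weight_u)
  then show ?thesis
    unfolding subst_eq using kappa_pos d_pos u_pos by (intro legal_subG) (simp_all add: weight_d)
qed

lemma legal_funpow_subst: "legal u d 0 w \<Longrightarrow> legal u d 0 ((subst q ^^ k) w)"
proof (induction k)
  case (Suc k)
  then show ?case using legal_subst[of 0 "(subst q ^^ k) w"] by simp
qed simp

lemma legal_half_subst:
  assumes "legal u d (u / 2) w"
  shows "legal u d (u / 2) (half_block q @ subst q w)"
proof -
  have "legal (\<kappa> * u) (\<kappa> * d) (\<kappa> * (u / 2)) w"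
    using assms kappa_pos by (simp only: legal_scale)
  then have "legal (u - 12 * (\<kappa> * d)) (\<kappa> * d) ((u - 12 * (\<kappa> * d)) / 2) w"
    unfolding weight_u by simp
  then have "legal u (\<kappa> * d) (u / 2) (replicate 6 True @ subD w)"
    using kappa_pos d_pos u_pos by (intro legal_half_subD) (simp_all add: weight_u)
  then have "legal u d (u / 2) (subG q (replicate 6 True @ subD w))"
    using kappa_pos d_pos u_pos by (intro legal_subG) (simp_all add: weight_d)
  moreover have "subG q (replicate 6 True @ subD w) = half_block q @ subst q w"
    using subG_replicate_True[of q 6] by (simp add: half_block_def subst_eq) (simp add: subG_def)
  ultimately show ?thesis by simp
qed

definition L :: nat where "L = 13 * (q + 1)"

lemma letter_facts: "act (letter_image q x) s = move x s" "length (letter_image q x) \<le> L"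
  "2 \<le> length (letter_image q x)"
  using act_letter_image even_q q_pos length_letter_image_le length_letter_image_ge
  by (auto simp: L_def)

lemma L_pos: "L > 0" by (simp add: L_def)

lemma act_half_block: "act (half_block q) s = s"
  unfolding half_block_def by (simp add: act_diag_blocks even_q)

lemma length_half_block: "length (half_block q) \<le> L"
  unfolding half_block_def L_def by (simp add: length_diag_blocks)

lemma wt_half_block: "wt u d (half_block q) = - (6 * (\<kappa> * d))"
proof -
  have b: "wt u d (diag_block q) = - (\<kappa> * d)"
    using weight_d by (simp add: diag_block_def wt_replicate)
  have "wt u d (concat (replicate n (diag_block q))) = - (real n * (\<kappa> * d))" for n
    by (induction n) (simp_all add: b algebra_simps)
  from this[of 6] show ?thesis by (simp add: half_block_def)
qed

text \<open>Renormalizes the start: after a prefix that does not change the tile, the substituted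
  letter is read from \<open>\<kappa> ^ k * z\<close>, close to 0. For \<open>u / 2\<close> each
  level prepends \<open>half_block\<close>, and the factor 2 in the length bound pays for
  it.\<close>

lemma start_word:
  assumes "z \<in> {0, u / 2}"
  shows "\<exists>w. length (w @ (subst q ^^ k) [False]) \<le> (2 * L) ^ k \<and> act w s = s \<and>
     legal u d z (w @ (subst q ^^ k) [False]) \<and> z + wt u d w = \<kappa> ^ k * z"
proof (induction k)
  case 0
  show ?case using assms u_pos u_lt_d by (intro exI[of _ "[]"]) auto
next
  case (Suc k)
  let ?v = "(subst q ^^ k) [False]"
  from Suc obtain w where w: "length (w @ ?v) \<le> (2 * L) ^ k" "act w s = s"
    "legal u d z (w @ ?v)" "z + wt u d w = \<kappa> ^ k * z" by blast
  have len: "length (subst q (w @ ?v)) \<le> L * (2 * L) ^ k"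
    using length_sub_word_le[of "letter_image q" L "w @ ?v"] letter_facts(2) w(1)
    by (meson le_trans mult_le_mono2)
  have acts: "act (subst q w) s = s"
    using act_sub_word[of "letter_image q", OF letter_facts(1)] w(2) by simp
  show ?case
  proof (cases "z = 0")
    case True
    show ?thesis
      using len acts legal_subst[OF w(3)] w(4) True
      by (intro exI[of _ "subst q w"]) (simp add: wt_subst)
  next
    case False
    then have z: "z = u / 2" using assms by simp
    have "length (half_block q) \<le> L * (2 * L) ^ k"
    proof -
      have "L * 1 \<le> L * (2 * L) ^ k" using L_pos by (intro mult_le_mono2 one_le_power) simp
      then show ?thesis using length_half_block by linarith
    qed
    moreover have "z - 6 * (\<kappa> * d) + \<kappa> * wt u d w = \<kappa> ^ Suc k * z"
    proof -
      have "u / 2 - 6 * (\<kappa> * d) + \<kappa> * wt u d w = \<kappa> * (u / 2 + wt u d w)"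
        using weight_u by (simp add: algebra_simps)
      then show ?thesis unfolding z using w(4)[unfolded z] by (simp only: power_Suc mult.assoc)
    qed
    moreover have "legal u d z (half_block q @ subst q (w @ ?v))"
      using legal_half_subst w(3) z by blast
    ultimately show ?thesis
      using len acts
      by (intro exI[of _ "half_block q @ subst q w"]) (simp add: act_half_block wt_half_block wt_subst)
  qed
qed

lemma step_eq: "legal u d z [x] \<Longrightarrow> step u (z, s) = (z + (if x then - d else u), move x s)"
  using u_add_d by (cases x) (auto simp: step_def)

lemma funpow_step_legal:
  "legal u d z w \<Longrightarrow> (step u ^^ length w) (z, s) = (z + wt u d w, act w s)"
proof (induction w arbitrary: z s)
  case (Cons x w)
  have l: "legal u d (z + (if x then - d else u)) w" using Cons.prems by simp
  have "legal u d z [x]" using Cons.prems legal_bounds[OF l] by simp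
  then have "step u (z, s) = (z + (if x then - d else u), move x s)" by (rule step_eq)
  then have "(step u ^^ length (x # w)) (z, s) = (step u ^^ length w) (z + (if x then - d else u), move x s)"
    by (simp add: funpow_swap1 del: prod.inject)
  also have "\<dots> = (z + (if x then - d else u) + wt u d w, act w (move x s))"
    by (rule Cons.IH[OF l])
  finally show ?case by (simp add: algebra_simps)
qed simp

text \<open>Modulo 1 the weight depends on the length alone, because
  \<open>- d = u - 1\<close>.\<close>

lemma wt_eq: "wt u d w = real (length w) * u - real (length (filter (\<lambda>x. x) w))"
  using u_add_d by (induction w) (simp_all add: algebra_simps)

text \<open>Since \<open>subst\<^sup>k [False]\<close> has the tiny weight \<open>\<epsilon> = \<kappa> ^ k * u\<close>, after \<open>j\<close> times its length
  the orbit of \<open>0\<close> under the rotation stands at \<open>j * \<epsilon>\<close>.\<close>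

lemma prefix_near:
  assumes "0 \<le> z" "z \<le> 1"
  shows "\<exists>m. real m \<le> real L ^ k / (\<kappa> ^ k * u) \<and>
    (\<forall>K. m \<le> length ((subst q ^^ K) [False]) \<longrightarrow>
       \<bar>wt u d (take m ((subst q ^^ K) [False])) - z\<bar> \<le> \<kappa> ^ k * u)"
proof -
  define \<epsilon> where "\<epsilon> = \<kappa> ^ k * u"
  have eps: "\<epsilon> > 0" using kappa_pos u_pos by (simp add: \<epsilon>_def)
  define v where "v = (subst q ^^ k) [False]"
  have wtv: "real (length v) * u - real (length (filter (\<lambda>x. x) v)) = \<epsilon>"
    using wt_eq[of v] wt_funpow_subst[of k "[False]"] by (simp add: v_def \<epsilon>_def)
  \<comment> \<open>Rounding up and subtracting 1 keeps \<open>j * \<epsilon>\<close> below 1 even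
    for \<open>z = 1\<close>. For \<open>z = 0\<close>, \<open>nat\<close> turns -1 into 0.\<close>
  define j where "j = nat (\<lceil>z / \<epsilon>\<rceil> - 1)"
  have j: "real j * \<epsilon> < 1" "\<bar>real j * \<epsilon> - z\<bar> \<le> \<epsilon>"
  proof -
    have "real j * \<epsilon> < 1 \<and> \<bar>real j * \<epsilon> - z\<bar> \<le> \<epsilon>"
    proof (cases "z = 0")
      case True
      then show ?thesis using eps by (simp add: j_def)
    next
      case False
      then have "z / \<epsilon> > 0" using assms eps by simp
      then have rj: "real j = of_int \<lceil>z / \<epsilon>\<rceil> - 1" by (simp add: j_def of_nat_nat)
      have "real j < z / \<epsilon>" "z / \<epsilon> \<le> real j + 1" unfolding rj by linarith+
      then have "real j * \<epsilon> < z" "z \<le> real j * \<epsilon> + \<epsilon>"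
        using eps by (simp_all add: field_simps)
      then show ?thesis using assms by auto
    qed
    then show "real j * \<epsilon> < 1" "\<bar>real j * \<epsilon> - z\<bar> \<le> \<epsilon>" by auto
  qed
  define m where "m = j * length v"
  have "real (length v) \<le> real L ^ k"
    using length_funpow_sub_word_le[of "letter_image q" L k "[False]"] letter_facts(2)
    unfolding v_def of_nat_power[symmetric] of_nat_le_iff by simp
  moreover have "real j \<le> 1 / \<epsilon>" using j(1) eps by (simp add: field_simps)
  ultimately have "real m \<le> (1 / \<epsilon>) * real L ^ k"
    unfolding m_def of_nat_mult using eps by (intro mult_mono) auto
  then have m: "real m \<le> real L ^ k / \<epsilon>" by simp
  have "wt u d (take m ((subst q ^^ K) [False])) = real j * \<epsilon>"
    if K: "m \<le> length ((subst q ^^ K) [False])" for K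
  proof -
    define a where "a = take m ((subst q ^^ K) [False])"
    have "legal u d 0 ((subst q ^^ K) [False])"
      using u_pos d_pos by (intro legal_funpow_subst) simp
    then have "legal u d 0 a"
      unfolding a_def by (metis append_take_drop_id legal_append)
    from legal_wt[OF this] have a: "0 \<le> wt u d a" "wt u d a < 1" using u_add_d by auto
    have "length a = m" using K by (simp add: a_def)
    then have "wt u d a = real m * u - real (length (filter (\<lambda>x. x) a))" using wt_eq[of a] by simp
    also have "real m * u = real j * (real (length v) * u)" by (simp add: m_def)
    also have "real (length v) * u = \<epsilon> + real (length (filter (\<lambda>x. x) v))" using wtv by simp
    finally have eq: "wt u d a - real j * \<epsilon> =
        of_int (int j * int (length (filter (\<lambda>x. x) v)) - int (length (filter (\<lambda>x. x) a)))"
      by (simp add: algebra_simps)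
    \<comment> \<open>Both numbers lie in the half-open unit interval and differ by an integer, so
      they coincide.\<close>
    moreover have "\<bar>wt u d a - real j * \<epsilon>\<bar> < 1" using a j(1) eps
      by (smt (verit) mult_nonneg_nonneg of_nat_0_le_iff)
    ultimately have "wt u d a - real j * \<epsilon> = 0"
      by (metis of_int_abs of_int_less_1_iff of_int_0 abs_eq_0 zero_less_abs_iff int_one_le_iff_zero_less linorder_not_le)
    then show ?thesis by (simp add: a_def)
  qed
  then show ?thesis using m j(2) unfolding \<epsilon>_def by (intro exI[of _ m]) auto
qed

text \<open>The word read is \<open>w\<close>, then \<open>b\<close> substituted \<open>K\<close>
  times, then \<open>a\<close>. Here \<open>w\<close> renormalizes the start, \<open>b\<close> leads
  from \<open>s\<close> to a tile \<open>t'\<close> at almost no displacement, and \<open>a\<close>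
  travels to \<open>z\<close> while carrying \<open>t'\<close> to \<open>t\<close>.\<close>

lemma discrete_density:
  "\<exists>e. \<forall>z0\<in>{0, u / 2}. \<forall>s t. \<exists>n0. \<forall>n\<ge>n0. \<forall>z\<in>{0..1}. \<exists>j z'.
     j \<le> n ^ e \<and> (step u ^^ j) (z0, s) = (z', t) \<and> \<bar>z' - z\<bar> \<le> 1 / real n"
proof -
  obtain A0 :: nat where A0: "real L / \<kappa> \<le> 2 ^ A0"
    using real_arch_pow[of 2 "real L / \<kappa>"] by (auto intro: less_imp_le)
  obtain A1 :: nat where A1: "1 / u \<le> 2 ^ A1"
    using real_arch_pow[of 2 "1 / u"] by (auto intro: less_imp_le)
  define A where "A = Suc (A0 + A1)"
  have A: "real L / \<kappa> \<le> 2 ^ A" "1 / u \<le> 2 ^ A"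
    using A0 A1 power_increasing[of A0 A "2::real"] power_increasing[of A1 A "2::real"]
    unfolding A_def by linarith+
  obtain E :: nat where E: "2 * L \<le> 2 ^ E"
    using self_le_power by (metis less_exp less_imp_le_nat)
  define X where "X = E * (Suc L * A)"
  have "\<exists>n0. \<forall>n\<ge>n0. \<forall>z\<in>{0..1}. \<exists>j z'.
     j \<le> n ^ Suc X \<and> (step u ^^ j) (z0, s) = (z', t) \<and> \<bar>z' - z\<bar> \<le> 1 / real n"
    if z0: "z0 \<in> {0, u / 2}" for z0 s t
  proof (rule exI, intro allI impI ballI)
    \<comment> \<open>Everything depending on \<open>s\<close> and \<open>t\<close> goes into
      \<open>c1\<close>, which affects \<open>n0\<close> but not the exponent. Of the 3, one is for
      the prefix \<open>a\<close>, one for the leading up move, and one offsets the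
      \<open>- 1\<close> in \<open>M\<close>.\<close>
    define c1 where "c1 = nat \<bar>cyc t\<bar> + nat \<bar>cyc s\<bar> + 3"
    define n0 where "n0 = Suc (8 ^ X * 2 ^ (E * (Suc L * A + c1)))"
    fix n :: nat and z :: real
    assume n: "n \<ge> n0" and z: "z \<in> {0..1}"
    have n_pos: "n > 0" using n by (simp add: n0_def)
    \<comment> \<open>Thus \<open>2 ^ k\<close> lies between \<open>4 * n\<close> and
      \<open>8 * n\<close>: the lower bound gives the precision, the upper one makes exponentials in
      \<open>k\<close> polynomial in \<open>n\<close>.\<close>
    define k where "k = (LEAST k. 4 * n \<le> 2 ^ k)"
    have "4 * n \<le> 2 ^ (4 * n)" by (simp add: less_imp_le)
    then have k1: "4 * n \<le> 2 ^ k" unfolding k_def by (rule LeastI)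
    have k2: "2 ^ k \<le> 8 * n"
    proof (cases k)
      case 0
      then show ?thesis using n_pos by simp
    next
      case (Suc k')
      then have "\<not> 4 * n \<le> 2 ^ k'" using not_less_Least[of k' "\<lambda>k. 4 * n \<le> 2 ^ k"] by (simp add: k_def)
      then show ?thesis by (simp add: Suc)
    qed
    have kap: "\<kappa> ^ k \<le> 1 / (4 * real n)"
    proof -
      have "\<kappa> ^ k \<le> (1 / 2) ^ k" using kappa_pos kappa_le by (intro power_mono) auto
      also have "\<dots> = 1 / 2 ^ k" by (simp add: power_one_over)
      also have "\<dots> \<le> 1 / (4 * real n)"
      proof -
        have "4 * real n \<le> 2 ^ k"
          using k1 by (metis of_nat_le_iff of_nat_mult of_nat_numeral of_nat_power)
        then show ?thesis using n_pos by (intro divide_left_mono) auto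
      qed
      finally show ?thesis .
    qed
    from prefix_near[of z k] z obtain m where
      m: "real m \<le> real L ^ k / (\<kappa> ^ k * u)" and
      near: "\<And>K. m \<le> length ((subst q ^^ K) [False]) \<Longrightarrow>
       \<bar>wt u d (take m ((subst q ^^ K) [False])) - z\<bar> \<le> \<kappa> ^ k * u" by auto
    \<comment> \<open>Large enough that \<open>2 ^ K\<close>, a lower bound for the length of
      \<open>V\<close>, exceeds the bound on \<open>m\<close>; still linear in
      \<open>k\<close>.\<close>
    define K where "K = A * Suc k"
    define V where "V = (subst q ^^ K) [False]"
    have mK: "m \<le> length V"
    proof -
      have "real m \<le> (real L / \<kappa>) ^ k * (1 / u)" using m by (simp add: power_divide)
      also have "\<dots> \<le> (2 ^ A) ^ k * 2 ^ A"
        using A kappa_pos u_pos by (intro mult_mono power_mono) auto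
      also have "\<dots> = 2 ^ K" by (simp add: K_def power_add power_mult)
      finally have "m \<le> 2 ^ K" by (metis of_nat_le_iff of_nat_numeral of_nat_power)
      also have "2 ^ K \<le> length V"
        using length_funpow_sub_word_ge[of 2 "letter_image q" K "[False]"] letter_facts(3)
        by (simp add: V_def)
      finally show ?thesis .
    qed
    define a where "a = take m V"
    have Va: "V = a @ drop m V" by (simp add: a_def)
    \<comment> \<open>The tile to aim at is chosen backwards, to compensate for the effect of
      \<open>a\<close>.\<close>
    obtain t' where t': "act a t' = t" using surj_act by blast
    have "\<bar>cyc (act a t') - cyc t'\<bar> \<le> int (L * K + 1)"
      by (rule cyc_act_prefix[of "letter_image q" L, OF letter_facts(1,2)])
        (use Va in \<open>simp add: V_def\<close>)
    then have dist: "\<bar>cyc t - cyc t'\<bar> \<le> int (L * K + 1)" using t' by simp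
    define M where "M = L * K + c1 - 1"
    have "\<bar>cyc t' - cyc (move False s)\<bar> \<le> int M"
      using dist cyc_move[of False s] unfolding M_def c1_def by simp
    then have "up_occurs ((subst q ^^ Suc M) [False]) s t'"
      by (rule up_occurs_funpow_subst[OF even_q q_pos])
    then obtain b r where b: "(subst q ^^ Suc M) [False] = b @ [False] @ r" "act b s = t'"
      unfolding up_occurs_def by blast
    have big: "(subst q ^^ (K + Suc M)) [False] = (subst q ^^ K) b @ V @ (subst q ^^ K) r"
      by (simp only: funpow_add comp_apply b(1) funpow_sub_word_append V_def)
    obtain w where w: "length (w @ (subst q ^^ (K + Suc M)) [False]) \<le> (2 * L) ^ (K + Suc M)"
      "act w s = s" "legal u d z0 (w @ (subst q ^^ (K + Suc M)) [False])"
      "z0 + wt u d w = \<kappa> ^ (K + Suc M) * z0"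
      using start_word[OF z0] by blast
    define v where "v = w @ (subst q ^^ K) b @ a"
    have wv: "w @ (subst q ^^ (K + Suc M)) [False] = v @ drop m V @ (subst q ^^ K) r"
      unfolding big v_def using Va by (metis append.assoc)
    have lv: "legal u d z0 v" using w(3) unfolding wv by (simp add: legal_append)
    have actv: "act v s = t"
      using w(2) b(2) t' act_funpow_sub_word[of "letter_image q", OF letter_facts(1)]
      by (simp add: v_def)
    have wtv: "z0 + wt u d v = \<kappa> ^ (K + Suc M) * z0 + \<kappa> ^ K * wt u d b + wt u d a"
      using w(4) by (simp add: v_def wt_funpow_subst)
    have wtb: "0 \<le> wt u d b" "wt u d b \<le> 1"
    proof -
      have "legal u d 0 ((subst q ^^ Suc M) [False])"
        using u_pos d_pos by (intro legal_funpow_subst) simp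
      then have "legal u d 0 b" unfolding b(1) by (simp add: legal_append)
      from legal_wt[OF this] show "0 \<le> wt u d b" "wt u d b \<le> 1" using u_add_d by auto
    qed
    have kK: "\<kappa> ^ K \<le> \<kappa> ^ k" "\<kappa> ^ (K + Suc M) \<le> \<kappa> ^ k"
    proof -
      have "k \<le> K" by (simp add: K_def A_def)
      then show "\<kappa> ^ K \<le> \<kappa> ^ k" "\<kappa> ^ (K + Suc M) \<le> \<kappa> ^ k"
        using kappa_pos kappa_le by (auto intro!: power_decreasing simp del: power_Suc add_Suc_right)
    qed
    have z0b: "0 \<le> z0" "z0 \<le> 1" using z0 u_pos u_lt_1 by auto
    have "\<bar>z0 + wt u d v - z\<bar> \<le> \<bar>\<kappa> ^ (K + Suc M) * z0\<bar> + \<bar>\<kappa> ^ K * wt u d b\<bar> + \<bar>wt u d a - z\<bar>"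
      unfolding wtv by linarith
    also have "\<bar>\<kappa> ^ (K + Suc M) * z0\<bar> \<le> \<kappa> ^ k * 1"
      unfolding abs_mult using kK z0b kappa_pos by (intro mult_mono) auto
    also have "\<bar>\<kappa> ^ K * wt u d b\<bar> \<le> \<kappa> ^ k * 1"
      unfolding abs_mult using kK wtb kappa_pos by (intro mult_mono) auto
    also have "\<bar>wt u d a - z\<bar> \<le> \<kappa> ^ k * 1"
    proof -
      have "\<bar>wt u d a - z\<bar> \<le> \<kappa> ^ k * u" using near[of K] mK by (simp add: a_def V_def)
      also have "\<dots> \<le> \<kappa> ^ k * 1" using u_lt_1 kappa_pos by (intro mult_left_mono) auto
      finally show ?thesis .
    qed
    \<comment> \<open>Three errors, each at most \<open>1 / (4 * n)\<close>.\<close>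
    finally have "\<bar>z0 + wt u d v - z\<bar> \<le> 4 * (1 / (4 * real n))"
      using kap zero_less_power[OF kappa_pos, of k] by linarith
    then have close: "\<bar>z0 + wt u d v - z\<bar> \<le> 1 / real n" by simp
    have "length v \<le> (2 * L) ^ (K + Suc M)" using w(1) unfolding wv by simp
    also have "\<dots> \<le> (2 ^ E) ^ (K + Suc M)" using E by (rule power_mono) simp
    also have "K + Suc M = Suc L * A * k + (Suc L * A + c1)"
      by (simp add: M_def K_def c1_def algebra_simps)
    also have "((2::nat) ^ E) ^ (Suc L * A * k + (Suc L * A + c1)) = (2 ^ k) ^ X * 2 ^ (E * (Suc L * A + c1))"
    proof -
      have "E * (Suc L * A * k + (Suc L * A + c1)) = k * X + E * (Suc L * A + c1)"
        by (simp add: X_def algebra_simps)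
      then show ?thesis by (simp only: power_add[symmetric] power_mult[symmetric])
    qed
    also have "\<dots> \<le> (8 * n) ^ X * 2 ^ (E * (Suc L * A + c1))"
      using k2 by (intro mult_le_mono1 power_mono) auto
    also have "\<dots> = n ^ X * (8 ^ X * 2 ^ (E * (Suc L * A + c1)))"
      by (simp only: power_mult_distrib mult.assoc mult.commute mult.left_commute)
    also have "\<dots> \<le> n ^ X * n" using n by (intro mult_le_mono2) (simp add: n0_def)
    finally have "length v \<le> n ^ Suc X" by (simp add: mult.commute)
    moreover have "(step u ^^ length v) (z0, s) = (z0 + wt u d v, t)"
      using funpow_step_legal[OF lv, of s] actv by simp
    ultimately show "\<exists>j z'. j \<le> n ^ Suc X \<and> (step u ^^ j) (z0, s) = (z', t) \<and>
       \<bar>z' - z\<bar> \<le> 1 / real n"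
      using close by blast
  qed
  then show ?thesis by blast
qed

end

section \<open>Billiard trajectories and the boundary of the strip\<close>

lemma flat_boundary_point_not_interior:
  assumes "flat_boundary_point R p \<nu>"
  shows "p \<notin> interior R"
proof
  assume "p \<in> interior R"
  then obtain e where e: "e > 0" "ball p e \<subseteq> R" by (meson mem_interior)
  from assms obtain e' where \<nu>: "norm \<nu> = 1" and
    e': "e' > 0" "R \<inter> ball p e' = {x \<in> ball p e'. \<nu> \<bullet> (x - p) \<ge> 0}"
    unfolding flat_boundary_point_def by blast
  define r where "r = min e e' / 2"
  have r: "r > 0" "r < e" "r < e'" using e e' by (auto simp: r_def)
  have "p - r *\<^sub>R \<nu> \<in> R \<inter> ball p e'"
    using e(2) r \<nu> by (auto simp: dist_norm)
  then have "\<nu> \<bullet> (p - r *\<^sub>R \<nu> - p) \<ge> 0" using e'(2) by blast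
  then show False using r \<nu> by (simp add: norm_eq_1)
qed

text \<open>If the normals differed, a small step along \<open>\<nu> - \<mu>\<close> would stay in
  one half-plane and leave the other. Hence the reflected velocity is determined.\<close>

lemma flat_boundary_point_unique:
  assumes "flat_boundary_point R p \<nu>" "flat_boundary_point R p \<mu>"
  shows "\<nu> = \<mu>"
proof (rule ccontr)
  assume ne: "\<nu> \<noteq> \<mu>"
  from assms obtain e e' where n: "norm \<nu> = 1" "norm \<mu> = 1" and
    e: "e > 0" "R \<inter> ball p e = {x \<in> ball p e. \<nu> \<bullet> (x - p) \<ge> 0}" and
    e': "e' > 0" "R \<inter> ball p e' = {x \<in> ball p e'. \<mu> \<bullet> (x - p) \<ge> 0}"
    unfolding flat_boundary_point_def by blast
  define v where "v = \<nu> - \<mu>"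
  have v: "norm v > 0" using ne by (simp add: v_def)
  have "v \<bullet> v > 0" using ne by (simp add: v_def)
  then have "\<nu> \<bullet> \<mu> < 1" using n by (simp add: v_def norm_eq_1 algebra_simps inner_commute)
  then have iv: "\<nu> \<bullet> v > 0" "\<mu> \<bullet> v < 0"
    using n by (simp_all add: v_def norm_eq_1 algebra_simps inner_commute)
  define r where "r = min e e' / (2 * norm v)"
  have r: "r > 0" using e e' v by (simp add: r_def)
  have "norm (r *\<^sub>R v) = min e e' / 2" using v r e(1) e'(1) by (simp add: r_def)
  then have x: "p + r *\<^sub>R v \<in> ball p e" "p + r *\<^sub>R v \<in> ball p e'"
    using e(1) e'(1) by (simp_all add: dist_norm)
  have "p + r *\<^sub>R v \<in> R \<inter> ball p e" unfolding e(2) using x(1) iv(1) r by simp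
  then have "\<mu> \<bullet> (p + r *\<^sub>R v - p) \<ge> 0" using e'(2) x(2) by blast
  then have "r * (\<mu> \<bullet> v) \<ge> 0" by simp
  then show False using r iv(2) by (simp add: zero_le_mult_iff)
qed

lemma billiard_law_flat:
  "billiard_law R p u w \<Longrightarrow> flat_boundary_point R p \<nu> \<Longrightarrow> w = u - (2 * (u \<bullet> \<nu>)) *\<^sub>R \<nu>"
  unfolding billiard_law_def
  using flat_boundary_point_not_interior flat_boundary_point_unique by blast

lemma billiard_law_interior: "billiard_law R p u w \<Longrightarrow> p \<in> interior R \<Longrightarrow> w = u"
  unfolding billiard_law_def using flat_boundary_point_not_interior by blast

lemma arrives_with_unique:
  assumes "arrives_with \<gamma> t u" "arrives_with \<gamma> t u'"
  shows "u = u'"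
proof -
  from assms obtain e e' where e: "e > 0" "\<forall>s\<in>{0..e}. \<gamma> (t - s) = \<gamma> t - s *\<^sub>R u"
    "e' > 0" "\<forall>s\<in>{0..e'}. \<gamma> (t - s) = \<gamma> t - s *\<^sub>R u'"
    unfolding arrives_with_def by blast
  have "min e e' *\<^sub>R u = min e e' *\<^sub>R u'"
    using e(2)[rule_format, of "min e e'"] e(4)[rule_format, of "min e e'"] e(1,3) by auto
  moreover have "min e e' \<noteq> 0" using e(1,3) by auto
  ultimately show ?thesis by (simp only: scaleR_cancel_left simp_thms)
qed

lemma trajectory_bounce:
  assumes "billiard_trajectory R \<gamma>" "t > 0" "arrives_with \<gamma> t u" "flat_boundary_point R (\<gamma> t) \<nu>"
  shows "departs_with \<gamma> t (u - (2 * (u \<bullet> \<nu>)) *\<^sub>R \<nu>)"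
  using assms arrives_with_unique billiard_law_flat unfolding billiard_trajectory_def by metis

lemma trajectory_through:
  assumes "billiard_trajectory R \<gamma>" "t > 0" "arrives_with \<gamma> t u" "\<gamma> t \<in> interior R"
  shows "departs_with \<gamma> t u"
  using assms arrives_with_unique billiard_law_interior unfolding billiard_trajectory_def by metis

text \<open>The billiard law is local, so straightness is extended to the supremum of the times up
  to which it holds. At an interior point short of \<open>l\<close> the law would prolong it
  further.\<close>

lemma trajectory_flight:
  assumes traj: "billiard_trajectory R \<gamma>" and t: "t \<ge> 0" and dep: "departs_with \<gamma> t w"
    and l: "l > 0" and int: "\<And>s. 0 < s \<Longrightarrow> s < l \<Longrightarrow> \<gamma> t + s *\<^sub>R w \<in> interior R"
  shows "arrives_with \<gamma> (t + l) w" "\<And>s. s \<in> {0..l} \<Longrightarrow> \<gamma> (t + s) = \<gamma> t + s *\<^sub>R w"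
proof -
  define S where "S = {r. 0 < r \<and> r \<le> l \<and> (\<forall>s\<in>{0..r}. \<gamma> (t + s) = \<gamma> t + s *\<^sub>R w)}"
  from dep obtain e where e: "e > 0" "\<forall>s\<in>{0..e}. \<gamma> (t + s) = \<gamma> t + s *\<^sub>R w"
    unfolding departs_with_def by blast
  have minS: "min e l \<in> S" using e l by (auto simp: S_def)
  have bdd: "bdd_above S" by (auto simp: S_def)
  define m where "m = Sup S"
  have m: "0 < m" "m \<le> l"
  proof -
    have "min e l \<le> m" unfolding m_def using minS bdd by (rule cSup_upper)
    then show "0 < m" using e l by auto
    show "m \<le> l" unfolding m_def using minS by (intro cSup_least) (blast, simp add: S_def)
  qed
  have below: "\<gamma> (t + s) = \<gamma> t + s *\<^sub>R w" if s: "0 \<le> s" "s < m" for s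
  proof -
    obtain r where "r \<in> S" "s < r" using s(2) less_cSupD[of S s] minS unfolding m_def by blast
    then show ?thesis using s(1) by (auto simp: S_def)
  qed
  have arr: "arrives_with \<gamma> (t + m) w \<and> \<gamma> (t + m) = \<gamma> t + m *\<^sub>R w"
  proof -
    have "t + m > 0" using t m by simp
    then obtain u where u: "arrives_with \<gamma> (t + m) u" using traj unfolding billiard_trajectory_def by blast
    then obtain e' where e': "e' > 0" "\<forall>s\<in>{0..e'}. \<gamma> (t + m - s) = \<gamma> (t + m) - s *\<^sub>R u"
      unfolding arrives_with_def by blast
    have eq: "\<gamma> (t + m) - s *\<^sub>R u = \<gamma> t + (m - s) *\<^sub>R w" if "0 < s" "s \<le> e'" "s \<le> m" for s
    proof -
      have "\<gamma> (t + m - s) = \<gamma> t + (m - s) *\<^sub>R w"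
        using below[of "m - s"] that by (simp add: add_diff_eq)
      then show ?thesis using e'(2) that by auto
    qed
    \<comment> \<open>The point at time \<open>t + m\<close> is not yet known to lie on the line;
      comparing the parameters \<open>r\<close> and \<open>r / 2\<close> eliminates it and yields
      \<open>u = w\<close>.\<close>
    define r where "r = min e' m"
    have r: "r > 0" "r \<le> e'" "r \<le> m" using e'(1) m by (auto simp: r_def)
    have "\<gamma> (t + m) - r *\<^sub>R u = \<gamma> t + (m - r) *\<^sub>R w"
      and "\<gamma> (t + m) - (r / 2) *\<^sub>R u = \<gamma> t + (m - r / 2) *\<^sub>R w"
      using eq[of r] eq[of "r / 2"] r by auto
    then have "(r / 2) *\<^sub>R u = (r / 2) *\<^sub>R w"
    proof -
      assume a: "\<gamma> (t + m) - r *\<^sub>R u = \<gamma> t + (m - r) *\<^sub>R w"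
        and b: "\<gamma> (t + m) - (r / 2) *\<^sub>R u = \<gamma> t + (m - r / 2) *\<^sub>R w"
      have "r *\<^sub>R u = (r / 2) *\<^sub>R u + (r / 2) *\<^sub>R u"
        by (simp only: scaleR_left_distrib[symmetric]) simp
      then have "(r / 2) *\<^sub>R u = (\<gamma> (t + m) - (r / 2) *\<^sub>R u) - (\<gamma> (t + m) - r *\<^sub>R u)"
        by simp
      also have "\<dots> = (m - r / 2) *\<^sub>R w - (m - r) *\<^sub>R w"
        unfolding a b by simp
      also have "\<dots> = (r / 2) *\<^sub>R w"
        by (simp only: scaleR_left_diff_distrib[symmetric]) simp
      finally show ?thesis .
    qed
    then have "u = w" using r by simp
    moreover from this have "\<gamma> (t + m) = \<gamma> t + m *\<^sub>R w"
      using eq[of r] r by (simp add: algebra_simps)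
    ultimately show ?thesis using u by simp
  qed
  have "m = l"
  proof (rule ccontr)
    assume "m \<noteq> l"
    then have ml: "m < l" using m by simp
    have "\<gamma> (t + m) \<in> interior R" using int m ml arr by simp
    then have "departs_with \<gamma> (t + m) w" using trajectory_through[OF traj] t m arr by simp
    then obtain e' where e': "e' > 0" "\<forall>s\<in>{0..e'}. \<gamma> (t + m + s) = \<gamma> (t + m) + s *\<^sub>R w"
      unfolding departs_with_def by blast
    define r where "r = min l (m + e')"
    have "\<gamma> (t + s) = \<gamma> t + s *\<^sub>R w" if "s \<in> {0..r}" for s
    proof (cases "s < m")
      case True
      then show ?thesis using below that by simp
    next
      case False
      then have "\<gamma> (t + m + (s - m)) = \<gamma> (t + m) + (s - m) *\<^sub>R w"
        using e'(2)[rule_format, of "s - m"] that False by (simp add: r_def)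
      then show ?thesis using arr by (simp add: algebra_simps)
    qed
    then have "r \<in> S" using m ml e' l by (auto simp: S_def r_def)
    then have "r \<le> m" unfolding m_def using bdd by (rule cSup_upper)
    then show False using ml e'(1) by (simp add: r_def)
  qed
  then show "arrives_with \<gamma> (t + l) w" "\<And>s. s \<in> {0..l} \<Longrightarrow> \<gamma> (t + s) = \<gamma> t + s *\<^sub>R w"
    using arr below by (auto simp: le_less)
qed

section \<open>Interior and flat boundary points of the L-strip\<close>

lemma flat_boundary_pointI:
  assumes "norm \<nu> = 1" "e > 0"
    and "\<And>a b. \<bar>a - x\<bar> < e \<Longrightarrow> \<bar>b - y\<bar> < e \<Longrightarrow> (a, b) \<in> R \<longleftrightarrow> \<nu> \<bullet> ((a, b) - (x, y)) \<ge> 0"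
  shows "flat_boundary_point R (x, y) \<nu>"
  unfolding flat_boundary_point_def
proof (intro conjI exI[of _ e])
  have "\<bar>a - x\<bar> < e \<and> \<bar>b - y\<bar> < e" if "(a, b) \<in> ball (x, y) e" for a b
  proof -
    have "dist (x, y) (a, b) < e" using that by simp
    then show ?thesis
      using dist_fst_le[of "(x, y)" "(a, b)"] dist_snd_le[of "(x, y)" "(a, b)"]
      by (simp add: dist_real_def abs_minus_commute)
  qed
  then show "R \<inter> ball (x, y) e = {z \<in> ball (x, y) e. \<nu> \<bullet> (z - (x, y)) \<ge> 0}"
    using assms(3) by (auto simp del: mem_ball diff_Pair)
qed (use assms in auto)

lemma L_strip_mem:
  "(a, b) \<in> L_strip \<longleftrightarrow> 0 \<le> b \<and> b \<le> 1 \<or>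
     (\<exists>i::int. 2 * of_int i \<le> a \<and> a \<le> 2 * of_int i + 1 \<and> 1 \<le> b \<and> b \<le> 2)"
  by (auto simp: L_strip_def)

lemma L_strip_interior_bottom:
  assumes "0 < y" "y < 1"
  shows "(x, y) \<in> interior L_strip"
proof (rule interiorI)
  show "open ((UNIV :: real set) \<times> {0<..<1::real})" by (intro open_Times) auto
qed (use assms in \<open>auto simp: L_strip_def\<close>)

lemma L_strip_interior_even:
  assumes "2 * of_int i < x" "x < 2 * of_int i + 1" "0 < y" "y < 2"
  shows "(x, y) \<in> interior L_strip"
proof (rule interiorI)
  show "open ({2 * of_int i<..<2 * of_int i + 1::real} \<times> {0<..<2::real})" by (intro open_Times) auto
  show "{2 * of_int i<..<2 * of_int i + 1} \<times> {0<..<2} \<subseteq> L_strip"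
  proof
    fix p :: "real \<times> real"
    assume "p \<in> {2 * of_int i<..<2 * of_int i + 1} \<times> {0<..<2}"
    then show "p \<in> L_strip"
      by (cases p; cases "snd p \<le> 1") (auto simp: L_strip_mem intro!: exI[of _ i])
  qed
qed (use assms in auto)

lemma L_strip_flat_bottom: "flat_boundary_point L_strip (x, 0) (0, 1)"
  by (rule flat_boundary_pointI[of _ 1]) (auto simp: L_strip_mem norm_Pair)

lemma L_strip_odd_column:
  assumes "2 * of_int i + 1 < a" "a < 2 * of_int i + 2"
  shows "(a, b) \<in> L_strip \<longleftrightarrow> 0 \<le> b \<and> b \<le> 1"
proof -
  have False if "2 * of_int j \<le> a" "a \<le> 2 * of_int j + 1" for j :: int
  proof -
    have "2 * real_of_int i < 2 * of_int j" "2 * real_of_int j < 2 * of_int i + 2"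
      using that assms by linarith+
    then have "i < j" "j < i + 1" by linarith+
    then show False by simp
  qed
  then show ?thesis by (auto simp: L_strip_mem)
qed

lemma L_strip_flat_middle:
  assumes "2 * of_int i + 1 < x" "x < 2 * of_int i + 2"
  shows "flat_boundary_point L_strip (x, 1) (0, -1)"
proof (rule flat_boundary_pointI[of _ "min (x - (2 * of_int i + 1)) (2 * of_int i + 2 - x)"])
  fix a b :: real
  assume *: "\<bar>a - x\<bar> < min (x - (2 * of_int i + 1)) (2 * of_int i + 2 - x)"
    "\<bar>b - 1\<bar> < min (x - (2 * of_int i + 1)) (2 * of_int i + 2 - x)"
  then have "2 * of_int i + 1 < a" "a < 2 * of_int i + 2" "b > 0" by linarith+
  then show "(a, b) \<in> L_strip \<longleftrightarrow> (0, - 1) \<bullet> ((a, b) - (x, 1)) \<ge> 0"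
    by (simp add: L_strip_odd_column)
qed (use assms in \<open>auto simp: norm_Pair\<close>)

lemma L_strip_flat_top:
  assumes "2 * of_int i < x" "x < 2 * of_int i + 1"
  shows "flat_boundary_point L_strip (x, 2) (0, -1)"
proof (rule flat_boundary_pointI[of _ "min (x - 2 * of_int i) (2 * of_int i + 1 - x)"])
  fix a b :: real
  assume *: "\<bar>a - x\<bar> < min (x - 2 * of_int i) (2 * of_int i + 1 - x)"
    "\<bar>b - 2\<bar> < min (x - 2 * of_int i) (2 * of_int i + 1 - x)"
  then have "2 * of_int i \<le> a" "a \<le> 2 * of_int i + 1" "b > 1" by linarith+
  then show "(a, b) \<in> L_strip \<longleftrightarrow> (0, - 1) \<bullet> ((a, b) - (x, 2)) \<ge> 0"
    by (auto simp: L_strip_mem intro!: exI[of _ i])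
qed (use assms in \<open>auto simp: norm_Pair\<close>)

lemma L_strip_flat_left:
  assumes "1 < y" "y < 2"
  shows "flat_boundary_point L_strip (2 * of_int i, y) (1, 0)"
proof (rule flat_boundary_pointI[of _ "min (y - 1) (2 - y)"])
  fix a b :: real
  assume *: "\<bar>a - 2 * of_int i\<bar> < min (y - 1) (2 - y)" "\<bar>b - y\<bar> < min (y - 1) (2 - y)"
  then have ab: "b > 1" "b < 2" "2 * of_int i - 1 < a" "a < 2 * of_int i + 1" by linarith+
  have "2 * of_int i \<le> a" if "2 * of_int j \<le> a" "a \<le> 2 * of_int j + 1" for j :: int
  proof -
    have "2 * real_of_int i < 2 * of_int j + 2" using that ab by linarith
    then have "i \<le> j" by linarith
    then have "real_of_int i \<le> of_int j" by simp
    then show ?thesis using that by linarith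
  qed
  then show "(a, b) \<in> L_strip \<longleftrightarrow> (1, 0) \<bullet> ((a, b) - (2 * of_int i, y)) \<ge> 0"
    using ab by (auto simp: L_strip_mem intro!: exI[of _ i])
qed (use assms in \<open>auto simp: norm_Pair\<close>)

lemma L_strip_flat_right:
  assumes "1 < y" "y < 2"
  shows "flat_boundary_point L_strip (2 * of_int i + 1, y) (-1, 0)"
proof (rule flat_boundary_pointI[of _ "min (y - 1) (2 - y)"])
  fix a b :: real
  assume *: "\<bar>a - (2 * of_int i + 1)\<bar> < min (y - 1) (2 - y)" "\<bar>b - y\<bar> < min (y - 1) (2 - y)"
  then have ab: "b > 1" "b < 2" "2 * of_int i < a" "a < 2 * of_int i + 2" by linarith+
  have "a \<le> 2 * of_int i + 1" if "2 * of_int j \<le> a" "a \<le> 2 * of_int j + 1" for j :: int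
  proof -
    have "2 * real_of_int j < 2 * of_int i + 2" using that ab by linarith
    then have "j \<le> i" by linarith
    then have "real_of_int j \<le> of_int i" by simp
    then show ?thesis using that by linarith
  qed
  then show "(a, b) \<in> L_strip \<longleftrightarrow> (- 1, 0) \<bullet> ((a, b) - (2 * of_int i + 1, y)) \<ge> 0"
    using ab by (auto simp: L_strip_mem intro!: exI[of _ i])
qed (use assms in \<open>auto simp: norm_Pair\<close>)

section \<open>The trajectory in tile coordinates\<close>

definition sg :: "bool \<Rightarrow> real" where "sg \<sigma> = (if \<sigma> then 1 else - 1)"

lemma sg_simps [simp]: "sg True = 1" "sg False = - 1" "sg (\<not> \<sigma>) = - sg \<sigma>" "sg \<sigma> * sg \<sigma> = 1"
  "sg \<sigma> * (sg \<sigma> * x) = x"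
  by (auto simp: sg_def)

text \<open>The row of a tile is the infinite horizontal strip of tiles through it, unfolded: \<open>x\<close> is
  measured along the row from the left edge of the tile and \<open>h \<in> {0..1}\<close> is half the vertical
  distance travelled since the last passage through the line at height 1.\<close>

fun row_pos :: "tile \<Rightarrow> real \<Rightarrow> real \<Rightarrow> real \<times> real" where
  "row_pos (Even i \<sigma>) x h = (2 * of_int i + 1 / 2 + sg \<sigma> * (x - 1 / 2), \<bar>1 - 2 * h\<bar>)"
| "row_pos (Odd i \<sigma>) x h = (2 * of_int i + 3 / 2 + sg \<sigma> * (x - 1 / 2), \<bar>1 - 2 * h\<bar>)"
| "row_pos (Top i \<sigma>) x h = (2 * of_int i + 1 / 2 + sg \<sigma> * (1 / 2 - \<bar>1 - x\<bar>), 2 - \<bar>1 - 2 * h\<bar>)"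

text \<open>Folding does not expand distances, so an error in the rotation coordinate is not
  enlarged in the plane.\<close>

lemma dist_row_pos: "dist (row_pos s x h) (row_pos s y h) \<le> \<bar>x - y\<bar>"
proof (cases s)
  case (Even i \<sigma>)
  then show ?thesis by (cases \<sigma>) (simp_all add: dist_Pair_Pair dist_real_def)
next
  case (Odd i \<sigma>)
  then show ?thesis by (cases \<sigma>) (simp_all add: dist_Pair_Pair dist_real_def)
next
  case (Top i \<sigma>)
  then show ?thesis by (cases \<sigma>) (auto simp: dist_Pair_Pair dist_real_def)
qed

text \<open>Here \<open>c\<close> and \<open>s\<close> are the absolute velocity components. The
  bound \<open>2 * c < s\<close> makes \<open>\<omega> < 1\<close>, so one row crosses at most one
  vertical tile edge.\<close>

locale strip_trajectory =
  fixes \<gamma> :: "real \<Rightarrow> real \<times> real" and c s :: real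
  assumes traj: "billiard_trajectory L_strip \<gamma>"
    and c_pos: "c > 0" and s_pos: "s > 0" and c_lt_s: "2 * c < s"
begin

definition "T = 1 / s"
definition "\<omega> = 2 * c / s"

fun row_dir :: "tile \<Rightarrow> real \<times> real" where
  "row_dir (Even i \<sigma>) = (sg \<sigma> * c, - s)"
| "row_dir (Odd i \<sigma>) = (sg \<sigma> * c, - s)"
| "row_dir (Top i \<sigma>) = (sg \<sigma> * c, s)"

lemma T_pos: "T > 0" and sT [simp]: "s * T = 1" and cT: "c * T = \<omega> / 2"
  and omega_pos: "\<omega> > 0" and omega_lt_1: "\<omega> < 1"
  using s_pos c_pos c_lt_s by (auto simp: T_def \<omega>_def field_simps)

lemma flight:
  assumes "t \<ge> 0" "departs_with \<gamma> t (v, w)" "\<gamma> t = (x, y)" "l > 0"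
    and "\<And>r. 0 < r \<Longrightarrow> r < l \<Longrightarrow> (x + r * v, y + r * w) \<in> interior L_strip"
  shows "arrives_with \<gamma> (t + l) (v, w)" "\<And>r. 0 \<le> r \<Longrightarrow> r \<le> l \<Longrightarrow> \<gamma> (t + r) = (x + r * v, y + r * w)"
  using trajectory_flight[OF traj assms(1,2,4)] assms(3,5) by auto

lemma bottom_up:
  assumes t: "t \<ge> 0" and dep: "departs_with \<gamma> t (sg \<sigma> * c, s)" and pos: "\<gamma> t = (x, 0)"
  shows "arrives_with \<gamma> (t + T) (sg \<sigma> * c, s)"
    "\<And>r. 0 \<le> r \<Longrightarrow> r \<le> T \<Longrightarrow> \<gamma> (t + r) = (x + sg \<sigma> * (c * r), s * r)"
proof -
  have int: "(x + r * (sg \<sigma> * c), 0 + r * s) \<in> interior L_strip" if "0 < r" "r < T" for r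
    using that s_pos by (intro L_strip_interior_bottom) (auto simp: T_def field_simps)
  from flight[OF t dep pos T_pos int]
  show "arrives_with \<gamma> (t + T) (sg \<sigma> * c, s)"
    "\<And>r. 0 \<le> r \<Longrightarrow> r \<le> T \<Longrightarrow> \<gamma> (t + r) = (x + sg \<sigma> * (c * r), s * r)"
    by (auto simp: mult_ac)
qed

lemma bottom_row:
  assumes t: "t \<ge> 0" and dep: "departs_with \<gamma> t (sg \<sigma> * c, - s)" and pos: "\<gamma> t = (x, 1)"
  shows "arrives_with \<gamma> (t + 2 * T) (sg \<sigma> * c, s)"
    "\<And>r. 0 \<le> r \<Longrightarrow> r \<le> 2 * T \<Longrightarrow> \<gamma> (t + r) = (x + sg \<sigma> * (c * r), \<bar>1 - s * r\<bar>)"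
proof -
  have int: "(x + r * (sg \<sigma> * c), 1 + r * - s) \<in> interior L_strip" if "0 < r" "r < T" for r
    using that s_pos by (intro L_strip_interior_bottom) (auto simp: T_def field_simps)
  note f1 = flight[OF t dep pos T_pos int]
  have p1: "\<gamma> (t + T) = (x + sg \<sigma> * (c * T), 0)" using f1(2)[of T] T_pos by (simp add: mult_ac)
  have "departs_with \<gamma> (t + T) ((sg \<sigma> * c, - s) - (2 * ((sg \<sigma> * c, - s) \<bullet> (0, 1))) *\<^sub>R (0, 1))"
    using t T_pos f1(1) p1 by (intro trajectory_bounce[OF traj]) (auto intro: L_strip_flat_bottom)
  then have "departs_with \<gamma> (t + T) (sg \<sigma> * c, s)" by simp
  note f2 = bottom_up[OF _ this p1]
  have t': "t + T \<ge> 0" using t T_pos by simp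
  show "arrives_with \<gamma> (t + 2 * T) (sg \<sigma> * c, s)" using f2(1)[OF t'] by (simp add: algebra_simps)
  show "\<gamma> (t + r) = (x + sg \<sigma> * (c * r), \<bar>1 - s * r\<bar>)" if r: "0 \<le> r" "r \<le> 2 * T" for r
  proof (cases "r \<le> T")
    case True
    then have "s * r \<le> s * T" using s_pos by (simp del: sT)
    then show ?thesis using f1(2)[of r] r True by (simp add: mult_ac)
  next
    case False
    then have "s * T \<le> s * r" using s_pos by (simp del: sT)
    moreover have "\<gamma> (t + r) = (x + sg \<sigma> * (c * T) + sg \<sigma> * (c * (r - T)), s * (r - T))"
      using f2(2)[OF t', of "r - T"] False r by simp
    ultimately show ?thesis by (simp add: algebra_simps)
  qed
qed

text \<open>\<open>\<rho> = 1\<close> is the ascent from height 1, \<open>\<rho> = -1\<close> the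
  descent from height 2. At most one side wall is hit, after time \<open>(1 - a) / c\<close>, and
  \<open>a + \<omega> / 2 \<noteq> 1\<close> keeps the pass from ending in a vertex.\<close>

lemma top_pass:
  assumes t: "t \<ge> 0" and \<rho>: "\<rho> \<in> {1, -1}" and dep: "departs_with \<gamma> t (sg \<sigma> * c, \<rho> * s)"
    and pos: "\<gamma> t = (2 * of_int i + 1 / 2 + sg \<sigma> * (a - 1 / 2), 3 / 2 - \<rho> / 2)"
    and a: "0 \<le> a" "a < 1" "a + \<omega> / 2 \<noteq> 1"
  shows "arrives_with \<gamma> (t + T) (sg (if a + \<omega> / 2 < 1 then \<sigma> else \<not> \<sigma>) * c, \<rho> * s)"
    "\<And>r. 0 \<le> r \<Longrightarrow> r \<le> T \<Longrightarrow>
       \<gamma> (t + r) = (2 * of_int i + 1 / 2 + sg \<sigma> * (1 / 2 - \<bar>1 - (a + c * r)\<bar>), 3 / 2 - \<rho> / 2 + \<rho> * (s * r))"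
proof -
  have int: "(2 * of_int i + 1 / 2 + sg \<tau> * (b - 1 / 2), 3 / 2 - \<rho> / 2 + \<rho> * y) \<in> interior L_strip"
    if "0 < b" "b < 1" "0 < y" "y < 1" for b y \<tau>
    using that \<rho> by (intro L_strip_interior_even[of i]) (auto simp: sg_def)
  have cr: "0 \<le> c * r" "c * r \<le> \<omega> / 2" "0 \<le> s * r" "s * r \<le> 1" if "0 \<le> r" "r \<le> T" for r
    using that c_pos s_pos mult_left_mono[of r T c] mult_left_mono[of r T s] by (auto simp: cT)
  have cr': "0 < c * r" "c * r < \<omega> / 2" "0 < s * r" "s * r < 1" if "0 < r" "r < T" for r
    using that c_pos s_pos mult_strict_left_mono[of r T c] mult_strict_left_mono[of r T s] by (auto simp: cT)
  have "arrives_with \<gamma> (t + T) (sg (if a + \<omega> / 2 < 1 then \<sigma> else \<not> \<sigma>) * c, \<rho> * s) \<and>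
    (\<forall>r. 0 \<le> r \<longrightarrow> r \<le> T \<longrightarrow>
       \<gamma> (t + r) = (2 * of_int i + 1 / 2 + sg \<sigma> * (1 / 2 - \<bar>1 - (a + c * r)\<bar>), 3 / 2 - \<rho> / 2 + \<rho> * (s * r)))"
  proof (cases "a + \<omega> / 2 < 1")
    case True
    have "(2 * of_int i + 1 / 2 + sg \<sigma> * (a - 1 / 2) + r * (sg \<sigma> * c), 3 / 2 - \<rho> / 2 + r * (\<rho> * s))
        \<in> interior L_strip" if "0 < r" "r < T" for r
      using int[of "a + c * r" "s * r" \<sigma>] cr'[OF that] a True by (simp add: algebra_simps)
    note f = flight[OF t dep pos T_pos this]
    have "\<gamma> (t + r) = (2 * of_int i + 1 / 2 + sg \<sigma> * (1 / 2 - \<bar>1 - (a + c * r)\<bar>), 3 / 2 - \<rho> / 2 + \<rho> * (s * r))"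
      if r: "0 \<le> r" "r \<le> T" for r
    proof -
      have "\<bar>1 - (a + c * r)\<bar> = 1 - (a + c * r)" using cr[OF r] True by simp
      then show ?thesis using f(2)[of r] r by (simp add: algebra_simps)
    qed
    then show ?thesis using f(1) True by simp
  next
    case False
    then have gt: "a + \<omega> / 2 > 1" using a(3) by simp
    define l where "l = (1 - a) / c"
    have cl: "c * l = 1 - a" using c_pos by (simp add: l_def)
    have l: "0 < l" "l < T"
    proof -
      show "0 < l" using a c_pos by (simp add: l_def)
      have "c * l < c * T" using gt by (simp add: cl cT)
      then show "l < T" using c_pos by simp
    qed
    have "(2 * of_int i + 1 / 2 + sg \<sigma> * (a - 1 / 2) + r * (sg \<sigma> * c), 3 / 2 - \<rho> / 2 + r * (\<rho> * s))
        \<in> interior L_strip" if r: "0 < r" "r < l" for r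
    proof -
      have "c * r < 1 - a" using mult_strict_left_mono[OF r(2) c_pos] cl by simp
      then show ?thesis using int[of "a + c * r" "s * r" \<sigma>] cr'[of r] r l a by (simp add: algebra_simps)
    qed
    note f1 = flight[OF t dep pos l(1) this]
    have p1: "\<gamma> (t + l) = (2 * of_int i + 1 / 2 + sg \<sigma> / 2, 3 / 2 - \<rho> / 2 + \<rho> * (s * l))"
    proof -
      have "sg \<sigma> * (a - 1 / 2) + l * (sg \<sigma> * c) = sg \<sigma> * (a - 1 / 2 + c * l)"
        by (simp add: algebra_simps)
      then show ?thesis using f1(2)[of l] l by (simp add: cl mult_ac)
    qed
    have y: "1 < 3 / 2 - \<rho> / 2 + \<rho> * (s * l)" "3 / 2 - \<rho> / 2 + \<rho> * (s * l) < 2"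
      using cr'[OF l] \<rho> by auto
    have "flat_boundary_point L_strip (\<gamma> (t + l)) (- sg \<sigma>, 0)"
      using L_strip_flat_left[OF y, of i] L_strip_flat_right[OF y, of i] p1
      by (cases \<sigma>) (simp_all add: add_ac)
    from trajectory_bounce[OF traj _ f1(1) this]
    have dep1: "departs_with \<gamma> (t + l) (sg (\<not> \<sigma>) * c, \<rho> * s)" using t l
      by (simp add: mult_ac)
    have t': "t + l \<ge> 0" and l': "T - l > 0" using t l by auto
    have *: "c * r \<le> \<omega> / 2" "s * r \<le> 1" "c * (l + r) = 1 - a + c * r" "s * (l + r) = s * l + s * r"
      if "0 \<le> r" "r \<le> T - l" for r
      using cr[of r] that l by (auto simp: distrib_left cl)
    have "(2 * of_int i + 1 / 2 + sg \<sigma> / 2 + r * (sg (\<not> \<sigma>) * c), 3 / 2 - \<rho> / 2 + \<rho> * (s * l) + r * (\<rho> * s))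
        \<in> interior L_strip" if r: "0 < r" "r < T - l" for r
    proof -
      have "c * r < 1" "0 < c * r" using cr'[of r] r l omega_lt_1 by auto
      moreover have "s * (l + r) < 1" "0 < s * (l + r)" using cr'[of "l + r"] r l by auto
      ultimately show ?thesis using int[of "c * r" "s * (l + r)" "\<not> \<sigma>"] by (simp add: algebra_simps)
    qed
    note f2 = flight[OF t' dep1 p1 l' this]
    have "\<gamma> (t + r) = (2 * of_int i + 1 / 2 + sg \<sigma> * (1 / 2 - \<bar>1 - (a + c * r)\<bar>), 3 / 2 - \<rho> / 2 + \<rho> * (s * r))"
      if r: "0 \<le> r" "r \<le> T" for r
    proof (cases "r \<le> l")
      case True
      then have "c * r \<le> 1 - a" using mult_left_mono[OF True, of c] c_pos cl by simp
      then show ?thesis using f1(2)[of r] r(1) True by (simp add: algebra_simps)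
    next
      case False
      then have "1 - a \<le> c * r" using mult_left_mono[of l r c] c_pos cl by simp
      moreover have "\<gamma> (t + l + (r - l)) = (2 * of_int i + 1 / 2 + sg \<sigma> / 2 + (r - l) * (sg (\<not> \<sigma>) * c),
          3 / 2 - \<rho> / 2 + \<rho> * (s * l) + (r - l) * (\<rho> * s))"
        using f2(2)[of "r - l"] False r by simp
      moreover have "(r - l) * (sg (\<not> \<sigma>) * c) = - sg \<sigma> * (c * r + a - 1)"
      proof -
        have "(r - l) * c = c * r + a - 1" using cl by (simp add: algebra_simps)
        moreover have "(r - l) * (sg (\<not> \<sigma>) * c) = - sg \<sigma> * ((r - l) * c)" by simp
        ultimately show ?thesis by simp
      qed
      ultimately show ?thesis by (simp add: algebra_simps)
    qed
    moreover have "t + l + (T - l) = t + T" by simp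
    ultimately show ?thesis using f2(1) False by (simp only: if_False simp_thms) auto
  qed
  then show "arrives_with \<gamma> (t + T) (sg (if a + \<omega> / 2 < 1 then \<sigma> else \<not> \<sigma>) * c, \<rho> * s)"
    "\<And>r. 0 \<le> r \<Longrightarrow> r \<le> T \<Longrightarrow>
       \<gamma> (t + r) = (2 * of_int i + 1 / 2 + sg \<sigma> * (1 / 2 - \<bar>1 - (a + c * r)\<bar>), 3 / 2 - \<rho> / 2 + \<rho> * (s * r))"
    by blast+
qed

lemma top_row:
  assumes t: "t \<ge> 0" and dep: "departs_with \<gamma> t (sg \<sigma> * c, s)"
    and pos: "\<gamma> t = (2 * of_int i + 1 / 2 + sg \<sigma> * (a - 1 / 2), 1)"
    and a: "0 \<le> a" "a < 1" "a + \<omega> / 2 \<noteq> 1" "a + \<omega> \<noteq> 1"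
  shows "arrives_with \<gamma> (t + 2 * T) (sg (if a + \<omega> < 1 then \<sigma> else \<not> \<sigma>) * c, - s)"
    "\<And>r. 0 \<le> r \<Longrightarrow> r \<le> 2 * T \<Longrightarrow>
       \<gamma> (t + r) = (2 * of_int i + 1 / 2 + sg \<sigma> * (1 / 2 - \<bar>1 - (a + c * r)\<bar>), 2 - \<bar>1 - s * r\<bar>)"
proof -
  define \<sigma>' where "\<sigma>' = (if a + \<omega> / 2 < 1 then \<sigma> else \<not> \<sigma>)"
  define a' where "a' = (if a + \<omega> / 2 < 1 then a + \<omega> / 2 else a + \<omega> / 2 - 1)"
  \<comment> \<open>If the ascent hit a wall, the descent starts in the mirrored frame with
    \<open>a' + x < \<omega> < 1\<close>, so it hits no second wall and both frames describe the
    same points.\<close>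
  have fold: "sg \<sigma>' * (1 / 2 - \<bar>1 - (a' + x)\<bar>) = sg \<sigma> * (1 / 2 - \<bar>1 - (a + \<omega> / 2 + x)\<bar>)"
    if "0 \<le> x" "x \<le> \<omega> / 2" for x
    using that a omega_lt_1 by (auto simp: \<sigma>'_def a'_def sg_def)
  have a': "0 < a'" "a' < 1" "a' + \<omega> / 2 \<noteq> 1"
    using a omega_pos omega_lt_1 by (auto simp: a'_def)
  have f1: "arrives_with \<gamma> (t + T) (sg \<sigma>' * c, s)"
    "\<And>r. 0 \<le> r \<Longrightarrow> r \<le> T \<Longrightarrow>
       \<gamma> (t + r) = (2 * of_int i + 1 / 2 + sg \<sigma> * (1 / 2 - \<bar>1 - (a + c * r)\<bar>), 1 + s * r)"
    using top_pass[OF t, of 1 \<sigma> i a] dep pos a by (auto simp: \<sigma>'_def)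
  have p1: "\<gamma> (t + T) = (2 * of_int i + 1 / 2 + sg \<sigma>' * (a' - 1 / 2), 2)"
    using f1(2)[of T] T_pos fold[of 0] omega_pos a' by (simp add: cT)
  have "flat_boundary_point L_strip (\<gamma> (t + T)) (0, - 1)"
    unfolding p1 using a' by (intro L_strip_flat_top[of i]) (auto simp: sg_def)
  from trajectory_bounce[OF traj _ f1(1) this]
  have dep1: "departs_with \<gamma> (t + T) (sg \<sigma>' * c, - 1 * s)" using t T_pos by simp
  have t': "t + T \<ge> 0" using t T_pos by simp
  have f2: "arrives_with \<gamma> (t + T + T) (sg (if a' + \<omega> / 2 < 1 then \<sigma>' else \<not> \<sigma>') * c, - 1 * s)"
    "\<And>r. 0 \<le> r \<Longrightarrow> r \<le> T \<Longrightarrow>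
       \<gamma> (t + T + r) = (2 * of_int i + 1 / 2 + sg \<sigma>' * (1 / 2 - \<bar>1 - (a' + c * r)\<bar>), 2 - s * r)"
    using top_pass[OF t', of "- 1" \<sigma>' i a'] dep1 p1 a' by auto
  have "(if a' + \<omega> / 2 < 1 then \<sigma>' else \<not> \<sigma>') = (if a + \<omega> < 1 then \<sigma> else \<not> \<sigma>)"
    using a omega_pos omega_lt_1 by (auto simp: a'_def \<sigma>'_def)
  then show "arrives_with \<gamma> (t + 2 * T) (sg (if a + \<omega> < 1 then \<sigma> else \<not> \<sigma>) * c, - s)"
    using f2(1) by (simp add: add.assoc)
  show "\<gamma> (t + r) = (2 * of_int i + 1 / 2 + sg \<sigma> * (1 / 2 - \<bar>1 - (a + c * r)\<bar>), 2 - \<bar>1 - s * r\<bar>)"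
    if r: "0 \<le> r" "r \<le> 2 * T" for r
  proof (cases "r \<le> T")
    case True
    then have "s * r \<le> s * T" using s_pos by (simp del: sT)
    then show ?thesis using f1(2)[of r] r True by simp
  next
    case False
    then have "s * T \<le> s * r" using s_pos by (simp del: sT)
    moreover have "0 \<le> c * (r - T)" "c * (r - T) \<le> \<omega> / 2"
      using False r c_pos mult_left_mono[of "r - T" T c] by (auto simp: cT)
    moreover have "\<omega> / 2 + c * (r - T) = c * r" by (simp add: right_diff_distrib cT)
    ultimately show ?thesis using f2(2)[of "r - T"] fold[of "c * (r - T)"] False r
      by (simp add: right_diff_distrib cT add.assoc)
  qed
qed

lemma cross_even:
  assumes "t > 0" "arrives_with \<gamma> t u" "\<gamma> t = (x, 1)" "2 * of_int i < x" "x < 2 * of_int i + 1"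
  shows "departs_with \<gamma> t u"
  using assms by (intro trajectory_through[OF traj]) (auto intro: L_strip_interior_even)

lemma cross_odd:
  assumes "t > 0" "arrives_with \<gamma> t (v, s)" "\<gamma> t = (x, 1)" "2 * of_int i + 1 < x" "x < 2 * of_int i + 2"
  shows "departs_with \<gamma> t (v, - s)"
  using trajectory_bounce[OF traj assms(1,2), of "(0, - 1)"] L_strip_flat_middle[OF assms(4,5)] assms(3)
  by simp

text \<open>At height 1 even columns are open and odd ones closed: a flight goes straight on in the
  former and is reflected in the latter, which is the rule of \<open>tile_up\<close>. The bounds on
  \<open>z\<close> exclude vertices.\<close>

lemma cross_row:
  assumes t: "t > 0" and z: "0 < z" "z < 2" "z \<noteq> 1"
    and arr: "arrives_with \<gamma> t (case p of Top i \<sigma> \<Rightarrow> (sg (if z < 1 then \<sigma> else \<not> \<sigma>) * c, - s)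
      | Even i \<sigma> \<Rightarrow> (sg \<sigma> * c, s) | Odd i \<sigma> \<Rightarrow> (sg \<sigma> * c, s))"
    and pos: "\<gamma> t = row_pos p z 1"
    and zp: "(z', p') = (if z < 1 then (z, move False p) else (z - 1, move True p))"
  shows "departs_with \<gamma> t (row_dir p')" "\<gamma> t = row_pos p' z' 0"
proof -
  have "departs_with \<gamma> t (row_dir p') \<and> \<gamma> t = row_pos p' z' 0"
  proof (cases p)
    case (Even i \<sigma>)
    show ?thesis
    proof (cases "z < 1")
      case True
      have "departs_with \<gamma> t (sg \<sigma> * c, s)"
        using arr pos Even z True by (intro cross_even[OF t, of _ _ i]) (auto simp: sg_def)
      then show ?thesis using True zp pos Even z by (simp add: move_def)
    next
      case False
      have "departs_with \<gamma> t (sg \<sigma> * c, - s)"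
        using arr pos Even z False
        by (intro cross_odd[OF t, of _ _ "if \<sigma> then i else i - 1"]) (auto simp: sg_def)
      then show ?thesis using False zp pos Even z by (auto simp: move_def sg_def)
    qed
  next
    case (Odd i \<sigma>)
    show ?thesis
    proof (cases "z < 1")
      case True
      have "departs_with \<gamma> t (sg \<sigma> * c, - s)"
        using arr pos Odd z True by (intro cross_odd[OF t, of _ _ i]) (auto simp: sg_def)
      then show ?thesis using True zp pos Odd z by (simp add: move_def)
    next
      case False
      have "departs_with \<gamma> t (sg \<sigma> * c, s)"
        using arr pos Odd z False
        by (intro cross_even[OF t, of _ _ "if \<sigma> then i + 1 else i"]) (auto simp: sg_def)
      then show ?thesis using False zp pos Odd z by (auto simp: move_def sg_def)
    qed
  next
    case (Top i \<sigma>)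
    have "departs_with \<gamma> t (sg (if z < 1 then \<sigma> else \<not> \<sigma>) * c, - s)"
      using arr pos Top z by (intro cross_even[OF t, of _ _ i]) (auto simp: sg_def abs_if)
    then show ?thesis using zp pos Top z by (auto simp: move_def sg_def abs_if)
  qed
  then show "departs_with \<gamma> t (row_dir p')" "\<gamma> t = row_pos p' z' 0" by auto
qed

text \<open>The two inequations keep the flight off vertices halfway through the row and at its
  end.\<close>

lemma row_step:
  assumes t: "t \<ge> 0" and dep: "departs_with \<gamma> t (row_dir p)" and pos: "\<gamma> t = row_pos p z 0"
    and z: "0 \<le> z" "z < 1" "z + \<omega> / 2 \<noteq> 1" "z + \<omega> \<noteq> 1"
    and zp: "(z', p') = step \<omega> (z, p)"
  shows "\<And>h. 0 \<le> h \<Longrightarrow> h \<le> 1 \<Longrightarrow> \<gamma> (t + 2 * T * h) = row_pos p (z + h * \<omega>) h"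
    "departs_with \<gamma> (t + 2 * T) (row_dir p')" "\<gamma> (t + 2 * T) = row_pos p' z' 0"
proof -
  have hT: "0 \<le> 2 * T * h" "2 * T * h \<le> 2 * T" "c * (2 * T * h) = h * \<omega>" "s * (2 * T * h) = 2 * h"
    if "0 \<le> h" "h \<le> 1" for h
    using that T_pos cT sT by (auto simp: algebra_simps)
  have "(\<forall>h. 0 \<le> h \<longrightarrow> h \<le> 1 \<longrightarrow> \<gamma> (t + 2 * T * h) = row_pos p (z + h * \<omega>) h) \<and>
    arrives_with \<gamma> (t + 2 * T) (case p of Top i \<sigma> \<Rightarrow> (sg (if z + \<omega> < 1 then \<sigma> else \<not> \<sigma>) * c, - s)
      | Even i \<sigma> \<Rightarrow> (sg \<sigma> * c, s) | Odd i \<sigma> \<Rightarrow> (sg \<sigma> * c, s))"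
  proof (cases p)
    case (Even i \<sigma>)
    have "departs_with \<gamma> t (sg \<sigma> * c, - s)" "\<gamma> t = (2 * of_int i + 1 / 2 + sg \<sigma> * (z - 1 / 2), 1)"
      using dep pos Even by auto
    note row = bottom_row[OF t this]
    show ?thesis
    proof (intro conjI allI impI)
      fix h :: real assume h: "0 \<le> h" "h \<le> 1"
      show "\<gamma> (t + 2 * T * h) = row_pos p (z + h * \<omega>) h"
        using row(2)[OF hT(1,2)[OF h]] Even unfolding hT(3,4)[OF h] by (simp add: algebra_simps)
    qed (use row(1) Even in simp)
  next
    case (Odd i \<sigma>)
    have "departs_with \<gamma> t (sg \<sigma> * c, - s)" "\<gamma> t = (2 * of_int i + 3 / 2 + sg \<sigma> * (z - 1 / 2), 1)"
      using dep pos Odd by auto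
    note row = bottom_row[OF t this]
    show ?thesis
    proof (intro conjI allI impI)
      fix h :: real assume h: "0 \<le> h" "h \<le> 1"
      show "\<gamma> (t + 2 * T * h) = row_pos p (z + h * \<omega>) h"
        using row(2)[OF hT(1,2)[OF h]] Odd unfolding hT(3,4)[OF h] by (simp add: algebra_simps)
    qed (use row(1) Odd in simp)
  next
    case (Top i \<sigma>)
    have "departs_with \<gamma> t (sg \<sigma> * c, s)" "\<gamma> t = (2 * of_int i + 1 / 2 + sg \<sigma> * (z - 1 / 2), 1)"
      using dep pos Top z by auto
    note row = top_row[OF t this z]
    show ?thesis
    proof (intro conjI allI impI)
      fix h :: real assume h: "0 \<le> h" "h \<le> 1"
      show "\<gamma> (t + 2 * T * h) = row_pos p (z + h * \<omega>) h"
        using row(2)[OF hT(1,2)[OF h]] Top unfolding hT(3,4)[OF h] by (simp add: algebra_simps)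
    qed (use row(1) Top in simp)
  qed
  then have rows: "\<And>h. 0 \<le> h \<Longrightarrow> h \<le> 1 \<Longrightarrow> \<gamma> (t + 2 * T * h) = row_pos p (z + h * \<omega>) h"
    and arr: "arrives_with \<gamma> (t + 2 * T) (case p of Top i \<sigma> \<Rightarrow> (sg (if z + \<omega> < 1 then \<sigma> else \<not> \<sigma>) * c, - s)
      | Even i \<sigma> \<Rightarrow> (sg \<sigma> * c, s) | Odd i \<sigma> \<Rightarrow> (sg \<sigma> * c, s))"
    by blast+
  show "\<gamma> (t + 2 * T * h) = row_pos p (z + h * \<omega>) h" if "0 \<le> h" "h \<le> 1" for h
    using rows that .
  have "(z', p') = (if z + \<omega> < 1 then (z + \<omega>, move False p) else (z + \<omega> - 1, move True p))"
    using zp by (simp add: step_def)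
  from cross_row[OF _ _ _ _ arr _ this] rows[of 1]
  show "departs_with \<gamma> (t + 2 * T) (row_dir p')" "\<gamma> (t + 2 * T) = row_pos p' z' 0"
    using t T_pos z omega_pos omega_lt_1 by auto
qed

end

section \<open>Density\<close>

context strip_slope begin

text \<open>An integer multiple of \<open>u\<close> minus an integer equals
  \<open>\<kappa> ^ k * u\<close>. If \<open>u\<close> had denominator \<open>b\<close>, then
  \<open>b * \<kappa> ^ k * u\<close> would be a positive integer, yet it is below 1 for large
  \<open>k\<close>.\<close>

lemma u_irrational: "u \<notin> \<rat>"
proof
  assume "u \<in> \<rat>"
  then obtain a :: int and n :: nat where "n \<noteq> 0" "u = of_int a / real n"
    by (auto simp: Rats_eq_int_div_nat)
  then obtain b :: int where ab: "b > 0" "u = of_int a / of_int b"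
    by (metis of_int_of_nat_eq of_nat_0_less_iff neq0_conv)
  obtain k where k: "\<kappa> ^ k < 1 / of_int b"
    using real_arch_pow_inv[of "1 / of_int b" \<kappa>] kappa_le ab(1) by auto
  define v where "v = (subst q ^^ k) [False]"
  have eq: "real (length v) * u - real (length (filter (\<lambda>x. x) v)) = \<kappa> ^ k * u"
    using wt_eq[of v] wt_funpow_subst[of k "[False]"] by (simp add: v_def)
  define m where "m = int (length v) * a - int (length (filter (\<lambda>x. x) v)) * b"
  have "of_int m = of_int b * (\<kappa> ^ k * u)"
    unfolding eq[symmetric] using ab by (simp add: m_def field_simps)
  moreover have "0 < of_int b * (\<kappa> ^ k * u)" using ab(1) kappa_pos u_pos by simp
  moreover have "of_int b * (\<kappa> ^ k * u) < 1"
  proof -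
    have "of_int b * \<kappa> ^ k < 1" using k ab(1) by (simp add: field_simps)
    then have "of_int b * \<kappa> ^ k * u < 1 * 1"
      using ab(1) kappa_pos u_pos u_lt_1 by (intro mult_strict_mono) auto
    then show ?thesis by (simp add: mult.assoc)
  qed
  ultimately have "0 < m" "m < 1" by (metis of_int_0_less_iff, metis of_int_less_1_iff)
  then show False by simp
qed

end

lemma irrational_mult_ne_int:
  assumes "x \<notin> \<rat>" "n > 0"
  shows "real n * x / 2 \<noteq> of_int m"
proof
  assume "real n * x / 2 = of_int m"
  then have "x = of_int (2 * m) / of_nat n" using assms(2) by (simp add: field_simps)
  then show False using assms(1) by (metis Rats_divide Rats_of_int Rats_of_nat)
qed

lemma L_strip_corners_cases:
  assumes "p \<in> L_strip_corners"
  shows "\<exists>m b. p = (of_int m, b) \<and> b \<in> {0, 1, 2}"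
proof -
  from assms obtain k b where kb: "b = 0 \<or> b = 1" and p: "p \<in> square_vertices (k, b)"
    by (auto simp: L_strip_corners_def L_strip_square_origins_def)
  from p have "fst p = of_int k \<or> fst p = of_int (k + 1)" "snd p \<in> {of_int b, of_int b + 1}"
    by (auto simp: square_vertices_def)
  moreover from this(2) kb have "snd p \<in> {0, 1, 2}" by auto
  ultimately show ?thesis by (metis prod.collapse)
qed

context strip_trajectory begin

text \<open>Up to an integer, \<open>z\<close> is \<open>(2 * j + e) * \<omega> / 2\<close>.
  Irrationality therefore excludes the vertices in every row, and \<open>row_step\<close> can be
  iterated.\<close>

lemma orbit:
  assumes irr: "\<omega> \<notin> \<rat>" and t0: "t0 \<ge> 0" and dep: "departs_with \<gamma> t0 (row_dir p0)"
    and pos: "\<gamma> t0 = row_pos p0 z0 0" and z0: "z0 \<in> {0, \<omega> / 2}"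
    and zp: "(step \<omega> ^^ j) (z0, p0) = (z, p)"
    and h: "0 \<le> h" "h \<le> 1"
  shows "\<gamma> (t0 + 2 * T * real j + 2 * T * h) = row_pos p (z + h * \<omega>) h"
proof -
  define e :: nat where "e = (if z0 = 0 then 0 else 1)"
  have z0e: "z0 = real e * \<omega> / 2" using z0 by (auto simp: e_def)
  have ne: "z + \<omega> / 2 \<noteq> 1" "z + \<omega> \<noteq> 1" if "z = real (2 * j + e) * \<omega> / 2 - of_int m" for z j m
  proof -
    have "z + \<omega> / 2 = real (2 * j + e + 1) * \<omega> / 2 - of_int m"
      "z + \<omega> = real (2 * j + e + 2) * \<omega> / 2 - of_int m"
      unfolding that by (simp_all add: field_simps)
    then show "z + \<omega> / 2 \<noteq> 1" "z + \<omega> \<noteq> 1"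
      using irrational_mult_ne_int[OF irr, of "2 * j + e + 1" "m + 1"]
        irrational_mult_ne_int[OF irr, of "2 * j + e + 2" "m + 1"] by auto
  qed
  have tj: "t0 + 2 * T * real j \<ge> 0" for j using t0 T_pos by simp
  have inv: "departs_with \<gamma> (t0 + 2 * T * real j) (row_dir p) \<and> \<gamma> (t0 + 2 * T * real j) = row_pos p z 0
    \<and> 0 \<le> z \<and> z < 1 \<and> (\<exists>m::int. z = real (2 * j + e) * \<omega> / 2 - of_int m)"
    if "(step \<omega> ^^ j) (z0, p0) = (z, p)" for z p
    using that
  proof (induction j arbitrary: z p)
    case 0
    then show ?case using dep pos z0 omega_pos omega_lt_1 z0e by (auto intro: exI[of _ 0])
  next
    case (Suc j)
    obtain y r where yr: "(step \<omega> ^^ j) (z0, p0) = (y, r)" by fastforce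
    from Suc.IH[OF this] obtain m where IH: "departs_with \<gamma> (t0 + 2 * T * real j) (row_dir r)"
      "\<gamma> (t0 + 2 * T * real j) = row_pos r y 0" "0 \<le> y" "y < 1"
      "y = real (2 * j + e) * \<omega> / 2 - of_int m" by blast
    have st: "(z, p) = step \<omega> (y, r)" using Suc.prems yr by simp
    have ne': "y + \<omega> / 2 \<noteq> 1" "y + \<omega> \<noteq> 1" using ne[OF IH(5)] by auto
    have eq: "t0 + 2 * T * real j + 2 * T = t0 + 2 * T * real (Suc j)" by (simp add: algebra_simps)
    note step = row_step(2,3)[OF tj IH(1-4) ne' st, unfolded eq]
    have "z = y + \<omega> \<or> z = y + \<omega> - 1" "0 \<le> z" "z < 1"
      using st IH(3,4) omega_pos omega_lt_1 by (auto simp: step_def split: if_splits)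
    moreover have "y + \<omega> = real (2 * Suc j + e) * \<omega> / 2 - of_int m"
      unfolding IH(5) by (simp add: field_simps)
    ultimately have "\<exists>m::int. z = real (2 * Suc j + e) * \<omega> / 2 - of_int m"
      by (metis diff_diff_eq of_int_1 of_int_add)
    then show ?case using step \<open>0 \<le> z\<close> \<open>z < 1\<close> by blast
  qed
  from inv[OF zp] obtain m where I: "departs_with \<gamma> (t0 + 2 * T * real j) (row_dir p)"
    "\<gamma> (t0 + 2 * T * real j) = row_pos p z 0" "0 \<le> z" "z < 1"
    "z = real (2 * j + e) * \<omega> / 2 - of_int m" by blast
  obtain z' p' where zp': "(z', p') = step \<omega> (z, p)" by (metis surj_pair)
  show ?thesis by (rule row_step(1)[OF tj I(1-4) ne[OF I(5)] zp' h])
qed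

text \<open>A positive slope leaves only the directions right-up and left-down, and staying in the
  table restricts the corner. From height 1 a row starts at once with \<open>z0 = 0\<close>; from
  heights 0 and 2 a flight of duration \<open>T\<close> leads to
  \<open>\<omega> / 2\<close>.\<close>

lemma start:
  assumes norm1: "c\<^sup>2 + s\<^sup>2 = 1" and slope: "initial_slope \<gamma> (s / c)" and corner: "\<gamma> 0 \<in> L_strip_corners"
  shows "\<exists>t0 p0 z0. 0 \<le> t0 \<and> t0 \<le> T \<and> z0 \<in> {0, \<omega> / 2} \<and> departs_with \<gamma> t0 (row_dir p0) \<and>
    \<gamma> t0 = row_pos p0 z0 0"
proof -
  from slope obtain w where w: "departs_with \<gamma> 0 w" "fst w \<noteq> 0" "snd w / fst w = s / c"
    unfolding initial_slope_def by blast
  obtain w1 w2 where w12: "w = (w1, w2)" by fastforce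
  have w2: "w2 = w1 * (s / c)" using w(2,3) w12 by (simp add: field_simps)
  have "norm w = 1" using w(1) unfolding departs_with_def by blast
  then have "w1\<^sup>2 + w2\<^sup>2 = 1" by (simp add: w12 norm_Pair)
  then have "w1\<^sup>2 * ((c\<^sup>2 + s\<^sup>2) / c\<^sup>2) = 1"
    using c_pos unfolding w2 by (simp add: field_simps power_mult_distrib)
  then have "w1\<^sup>2 = c\<^sup>2" using c_pos by (simp add: norm1 field_simps)
  then have "w1 = c \<or> w1 = - c" by (simp add: power2_eq_iff)
  then obtain \<epsilon> where "w = (sg \<epsilon> * c, sg \<epsilon> * s)"
  proof
    assume "w1 = c"
    then show ?thesis using that[of True] w2 w12 c_pos by simp
  next
    assume "w1 = - c"
    then show ?thesis using that[of False] w2 w12 c_pos by simp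
  qed
  with w(1) have dep: "departs_with \<gamma> 0 (sg \<epsilon> * c, sg \<epsilon> * s)" by simp
  from corner obtain m :: int and b :: real where mb: "\<gamma> 0 = (of_int m, b)" "b \<in> {0, 1, 2}"
    using L_strip_corners_cases by blast
  from dep obtain e where e: "e > 0" "\<forall>r\<in>{0..e}. \<gamma> (0 + r) = \<gamma> 0 + r *\<^sub>R (sg \<epsilon> * c, sg \<epsilon> * s)"
    unfolding departs_with_def by blast
  define r where "r = min e (T / 2)"
  have r: "0 < r" "r \<le> e" "r < T" using e T_pos by (auto simp: r_def)
  have cr: "0 < c * r" "c * r < 1" "0 < s * r" "s * r < 1"
    using r c_pos s_pos mult_strict_left_mono[of r T c] mult_strict_left_mono[of r T s] omega_lt_1
    by (auto simp: cT)
  have "\<gamma> r = \<gamma> 0 + r *\<^sub>R (sg \<epsilon> * c, sg \<epsilon> * s)" using e(2)[rule_format, of r] r by simp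
  then have "\<gamma> r = (of_int m + sg \<epsilon> * (c * r), b + sg \<epsilon> * (s * r))" using mb by (simp add: mult_ac)
  moreover have "\<gamma> r \<in> L_strip" using traj r unfolding billiard_trajectory_def by simp
  ultimately have in_strip: "(of_int m + sg \<epsilon> * (c * r), b + sg \<epsilon> * (s * r)) \<in> L_strip" by simp
  have le: "0 \<le> T" "T \<le> T" "0 \<le> (0::real)" using T_pos by auto
  show ?thesis
  proof (cases \<epsilon>)
    case True
    have in': "(of_int m + c * r, b + s * r) \<in> L_strip" using in_strip True by simp
    consider "b = 0" | "b = 1" | "b = 2" using mb(2) by auto
    then show ?thesis
    proof cases
      case 1
      have "departs_with \<gamma> 0 (sg True * c, s)" using dep True by simp
      note up = bottom_up[OF le(3) this, of "of_int m"]
      have arr: "arrives_with \<gamma> T (c, s)" using up(1) mb 1 by simp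
      have pT: "\<gamma> T = (of_int m + \<omega> / 2, 1)" using up(2)[of T] mb 1 le by (simp add: cT)
      show ?thesis
      proof (cases "even m")
        case True
        then obtain i where i: "m = 2 * i" by (elim evenE)
        have "departs_with \<gamma> T (row_dir (Top i True))"
          using cross_even[OF T_pos arr pT, of i] i omega_pos omega_lt_1 by simp
        then show ?thesis using pT i omega_lt_1 le omega_pos
          by (intro exI[of _ T] exI[of _ "Top i True"] exI[of _ "\<omega> / 2"]) (simp add: abs_if)
      next
        case False
        then obtain i where i: "m = 2 * i + 1" by (elim oddE)
        have "departs_with \<gamma> T (row_dir (Odd i True))"
          using cross_odd[OF T_pos arr pT, of i] i omega_pos omega_lt_1 by simp
        then show ?thesis using pT i omega_lt_1 le omega_pos
          by (intro exI[of _ T] exI[of _ "Odd i True"] exI[of _ "\<omega> / 2"]) simp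
      qed
    next
      case 2
      then obtain i :: int where i: "2 * of_int i \<le> of_int m + c * r" "of_int m + c * r \<le> 2 * of_int i + 1"
        using in' cr by (auto simp: L_strip_mem)
      then have "2 * i < m + 1" "m < 2 * i + 1" using cr by linarith+
      then have m: "m = 2 * i" by simp
      show ?thesis using dep True mb 2 m le
        by (intro exI[of _ 0] exI[of _ "Top i True"] exI[of _ "0"]) simp
    next
      case 3
      then show ?thesis using in' cr by (auto simp: L_strip_mem)
    qed
  next
    case False
    have in': "(of_int m - c * r, b - s * r) \<in> L_strip" using in_strip False by simp
    consider "b = 0" | "b = 1" | "b = 2" using mb(2) by auto
    then show ?thesis
    proof cases
      case 1
      then show ?thesis using in' cr by (auto simp: L_strip_mem)
    next
      case 2
      show ?thesis
      proof (cases "even m")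
        case True
        then obtain i where i: "m = 2 * i" by (elim evenE)
        show ?thesis using dep False mb 2 i le
          by (intro exI[of _ 0] exI[of _ "Odd (i - 1) False"] exI[of _ "0"]) simp
      next
        case odd: False
        then obtain i where i: "m = 2 * i + 1" by (elim oddE)
        show ?thesis using dep False mb 2 i le
          by (intro exI[of _ 0] exI[of _ "Even i False"] exI[of _ "0"]) simp
      qed
    next
      case 3
      then obtain i :: int where i: "2 * of_int i \<le> of_int m - c * r" "of_int m - c * r \<le> 2 * of_int i + 1"
        using in' cr by (auto simp: L_strip_mem)
      then have "2 * i < m" "m < 2 * i + 2" using cr by linarith+
      then have m: "m = 2 * i + 1" by simp
      have d0: "departs_with \<gamma> 0 (sg False * c, - 1 * s)" using dep False by simp
      have p0: "\<gamma> 0 = (2 * of_int i + 1 / 2 + sg False * (0 - 1 / 2), 3 / 2 - - 1 / 2)"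
        using mb 3 m by simp
      have ne: "0 + \<omega> / 2 \<noteq> 1" using omega_lt_1 by simp
      note pass = top_pass[OF le(3) _ d0 p0 _ _ ne]
      have arr: "arrives_with \<gamma> T (- c, - s)" using pass(1) omega_lt_1 by simp
      have pT: "\<gamma> T = (2 * of_int i + 1 - \<omega> / 2, 1)"
        using pass(2)[of T] le omega_lt_1 by (simp add: cT)
      have "departs_with \<gamma> T (row_dir (Even i False))"
        using cross_even[OF T_pos arr pT, of i] omega_pos omega_lt_1 by simp
      then show ?thesis using pT le
        by (intro exI[of _ T] exI[of _ "Even i False"] exI[of _ "\<omega> / 2"]) simp
    qed
  qed
qed

end

text \<open>Following a point of the face back along the flow to the lower edge of its row may lead one
  tile to the left, hence the two descriptions.\<close>

lemma face_tiles:
  assumes "S \<in> L_strip_faces"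
  shows "\<exists>p p'. \<forall>Q\<in>S. \<exists>h\<in>{0..1}. \<exists>x\<in>{0..1}. Q = row_pos p x h \<and> Q = row_pos p' (x + 1) h"
proof -
  from assms obtain k b where S: "S = unit_square (k, b)" and kb: "b = 0 \<or> b = 1 \<and> even k"
    by (auto simp: L_strip_faces_def L_strip_square_origins_def)
  have Q: "\<exists>x y. Q = (of_int k + x, of_int b + y) \<and> x \<in> {0..1} \<and> y \<in> {0..1}" if "Q \<in> S" for Q
    using that unfolding S unit_square_def
    by (intro exI[of _ "fst Q - of_int k"] exI[of _ "snd Q - of_int b"]) (auto simp: algebra_simps)
  consider i where "b = 0" "k = 2 * i" | i where "b = 0" "k = 2 * i + 1" | i where "b = 1" "k = 2 * i"
    using kb by (metis evenE oddE)
  then show ?thesis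
  proof cases
    case 1
    have "\<exists>h\<in>{0..1}. \<exists>x\<in>{0..1}. Q = row_pos (Even i True) x h \<and> Q = row_pos (Odd (i - 1) True) (x + 1) h"
      if QS: "Q \<in> S" for Q
    proof -
      from Q[OF QS] obtain x y where "Q = (of_int k + x, of_int b + y)" "x \<in> {0..1}" "y \<in> {0..1}"
        by blast
      then show ?thesis using 1 by - (rule bexI[of _ "(1 - y) / 2"], rule bexI[of _ x], auto simp: field_simps)
    qed
    then show ?thesis by blast
  next
    case 2
    have "\<exists>h\<in>{0..1}. \<exists>x\<in>{0..1}. Q = row_pos (Odd i True) x h \<and> Q = row_pos (Even i True) (x + 1) h"
      if QS: "Q \<in> S" for Q
    proof -
      from Q[OF QS] obtain x y where "Q = (of_int k + x, of_int b + y)" "x \<in> {0..1}" "y \<in> {0..1}"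
        by blast
      then show ?thesis using 2 by - (rule bexI[of _ "(1 - y) / 2"], rule bexI[of _ x], auto simp: field_simps)
    qed
    then show ?thesis by blast
  next
    case 3
    have "\<exists>h\<in>{0..1}. \<exists>x\<in>{0..1}. Q = row_pos (Top i True) x h \<and> Q = row_pos (Top i False) (x + 1) h"
      if QS: "Q \<in> S" for Q
    proof -
      from Q[OF QS] obtain x y where "Q = (of_int k + x, of_int b + y)" "x \<in> {0..1}" "y \<in> {0..1}"
        by blast
      then show ?thesis using 3 by - (rule bexI[of _ "y / 2"], rule bexI[of _ x], auto simp: field_simps)
    qed
    then show ?thesis by blast
  qed
qed

context strip_slope begin

lemma slope_density:
  "\<exists>\<beta>>0. \<forall>\<gamma>. billiard_trajectory L_strip \<gamma> \<and> \<gamma> 0 \<in> L_strip_corners \<and> initial_slope \<gamma> (2 / u) \<longrightarrow>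
     (\<forall>S\<in>L_strip_faces. \<exists>c\<^sub>0 :: nat. \<forall>n\<ge>c\<^sub>0. \<forall>Q\<in>S.
        \<exists>t\<in>{0..real n powr \<beta>}. dist (\<gamma> t) Q \<le> 1 / real n)"
proof -
  obtain e where e: "\<forall>z0\<in>{0, u / 2}. \<forall>s t. \<exists>n0. \<forall>n\<ge>n0. \<forall>z\<in>{0..1}. \<exists>j z'.
     j \<le> n ^ e \<and> (step u ^^ j) (z0, s) = (z', t) \<and> \<bar>z' - z\<bar> \<le> 1 / real n"
    using discrete_density by blast
  define N where "N = sqrt (u\<^sup>2 + 4)"
  have N: "N > 0" "N\<^sup>2 = u\<^sup>2 + 4" unfolding N_def by (auto simp: add_nonneg_pos)
  have "\<exists>c\<^sub>0 :: nat. \<forall>n\<ge>c\<^sub>0. \<forall>Q\<in>S. \<exists>t\<in>{0..real n powr real (Suc e)}. dist (\<gamma> t) Q \<le> 1 / real n"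
    if \<gamma>: "billiard_trajectory L_strip \<gamma>" "\<gamma> 0 \<in> L_strip_corners" "initial_slope \<gamma> (2 / u)"
      and S: "S \<in> L_strip_faces" for \<gamma> S
  proof -
    \<comment> \<open>The unit vector of slope \<open>2 / u\<close>, which makes the rotation number
      equal to \<open>u\<close>.\<close>
    interpret F: strip_trajectory \<gamma> "u / N" "2 / N"
      using \<gamma>(1) u_pos u_lt_1 N by unfold_locales (auto simp: divide_strict_right_mono)
    have om: "F.\<omega> = u" using N unfolding F.\<omega>_def by simp
    have T2: "F.T \<le> 2"
    proof -
      have "u * u < 1 * 1" using u_pos u_lt_1 by (intro mult_strict_mono) auto
      then have "N\<^sup>2 \<le> 4\<^sup>2" using N(2) by (simp add: power2_eq_square)
      then have "N \<le> 4" by (rule power2_le_imp_le) simp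
      then show ?thesis using N by (simp add: F.T_def)
    qed
    have "(u / N)\<^sup>2 + (2 / N)\<^sup>2 = (u\<^sup>2 + 4) / N\<^sup>2" by (simp add: power_divide add_divide_distrib)
    also have "\<dots> = 1" using N(1) by (simp add: N(2)[symmetric])
    finally have "(u / N)\<^sup>2 + (2 / N)\<^sup>2 = 1" .
    moreover have "(2 / N) / (u / N) = 2 / u" using N by simp
    ultimately obtain t0 p0 z0 where st: "0 \<le> t0" "t0 \<le> F.T" "z0 \<in> {0, F.\<omega> / 2}"
      "departs_with \<gamma> t0 (F.row_dir p0)" "\<gamma> t0 = row_pos p0 z0 0"
      using F.start[OF _ _ \<gamma>(2)] \<gamma>(3) by metis
    obtain p p' where pp: "\<forall>Q\<in>S. \<exists>h\<in>{0..1}. \<exists>x\<in>{0..1}. Q = row_pos p x h \<and> Q = row_pos p' (x + 1) h"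
      using face_tiles[OF S] by blast
    have z0: "z0 \<in> {0, u / 2}" using st(3) om by simp
    obtain n1 where n1: "\<forall>n\<ge>n1. \<forall>z\<in>{0..1}. \<exists>j z'.
        j \<le> n ^ e \<and> (step u ^^ j) (z0, p0) = (z', p) \<and> \<bar>z' - z\<bar> \<le> 1 / real n"
      using e z0 by blast
    obtain n2 where n2: "\<forall>n\<ge>n2. \<forall>z\<in>{0..1}. \<exists>j z'.
        j \<le> n ^ e \<and> (step u ^^ j) (z0, p0) = (z', p') \<and> \<bar>z' - z\<bar> \<le> 1 / real n"
      using e z0 by blast
    show ?thesis
    proof (intro exI[of _ "max 10 (max n1 n2)"] allI impI ballI)
      fix n :: nat and Q assume n: "max 10 (max n1 n2) \<le> n" and "Q \<in> S"
      then obtain h x where hx: "0 \<le> h" "h \<le> 1" "0 \<le> x" "x \<le> 1" "Q = row_pos p x h" "Q = row_pos p' (x + 1) h"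
        using pp by fastforce
      have hu: "0 \<le> h * u" "h * u \<le> 1"
        using hx u_pos u_lt_1 mult_mono[of h 1 u 1] by auto
      \<comment> \<open>At height parameter \<open>h\<close> the row has advanced by
        \<open>h * u\<close>, so the entry point aimed at is \<open>x - h * u\<close>, or that plus
        1 in the tile to the left when it is negative.\<close>
      have "\<exists>r z j z'. Q = row_pos r (z + h * u) h \<and> j \<le> n ^ e \<and> (step u ^^ j) (z0, p0) = (z', r) \<and>
          \<bar>z' - z\<bar> \<le> 1 / real n"
      proof (cases "x - h * u \<ge> 0")
        case True
        then have "x - h * u \<in> {0..1}" using hx hu by auto
        then obtain j z' where "j \<le> n ^ e" "(step u ^^ j) (z0, p0) = (z', p)" "\<bar>z' - (x - h * u)\<bar> \<le> 1 / real n"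
          using n1 n by fastforce
        then show ?thesis using hx(5)
          by (intro exI[of _ p] exI[of _ "x - h * u"] exI[of _ j] exI[of _ z']) auto
      next
        case False
        then have "x + 1 - h * u \<in> {0..1}" using hx hu by auto
        then obtain j z' where "j \<le> n ^ e" "(step u ^^ j) (z0, p0) = (z', p')" "\<bar>z' - (x + 1 - h * u)\<bar> \<le> 1 / real n"
          using n2 n by fastforce
        then show ?thesis using hx(6)
          by (intro exI[of _ p'] exI[of _ "x + 1 - h * u"] exI[of _ j] exI[of _ z']) auto
      qed
      then obtain r z j z' where J: "Q = row_pos r (z + h * u) h" "j \<le> n ^ e"
        "(step u ^^ j) (z0, p0) = (z', r)" "\<bar>z' - z\<bar> \<le> 1 / real n" by blast
      define t where "t = t0 + 2 * F.T * real j + 2 * F.T * h"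
      have "\<gamma> t = row_pos r (z' + h * u) h"
        using F.orbit[OF _ st(1,4,5,3) _ hx(1,2), unfolded om, OF u_irrational J(3)] by (simp add: t_def)
      then have "dist (\<gamma> t) Q \<le> 1 / real n"
        using dist_row_pos[of r "z' + h * u" h "z + h * u"] J(1,4) by simp
      moreover have "t \<in> {0..real n powr real (Suc e)}"
      proof -
        have "0 \<le> t" using st(1) F.T_pos hx(1) by (simp add: t_def)
        have "F.T * h \<le> 2 * 1" using T2 F.T_pos hx by (intro mult_mono) auto
        moreover have "F.T * real j \<le> 2 * real (n ^ e)" using T2 F.T_pos J(2) by (intro mult_mono) auto
        \<comment> \<open>The constants sum to 10, which one extra factor \<open>n \<ge> 10\<close>
          absorbs; hence the exponent \<open>Suc e\<close>.\<close>
        ultimately have "t \<le> 6 + 4 * real (n ^ e)" using st(2) T2 by (simp add: t_def)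
        also have "\<dots> \<le> 10 * real (n ^ e)"
        proof -
          have "1 \<le> real n ^ e" using n by (intro one_le_power) simp
          then show ?thesis by simp
        qed
        also have "\<dots> \<le> real n * real (n ^ e)" using n by (intro mult_right_mono) auto
        also have "\<dots> = real n powr real (Suc e)" using n by (subst powr_realpow) auto
        finally show ?thesis using \<open>0 \<le> t\<close> by simp
      qed
      ultimately show "\<exists>t\<in>{0..real n powr real (Suc e)}. dist (\<gamma> t) Q \<le> 1 / real n" by blast
    qed
  qed
  then show ?thesis by (intro exI[of _ "real (Suc e)"]) auto
qed

lemma slope_eq: "2 / u = 2 * (1 + \<tau>)" by (simp add: u_def)

lemma quadratic_irrational_slope: "quadratic_irrational (2 / u)"
  unfolding quadratic_irrational_def
proof (intro conjI exI)
  show "2 / u \<notin> \<rat>"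
  proof
    assume "2 / u \<in> \<rat>"
    then have "2 / (2 / u) \<in> \<rat>" by (rule Rats_divide[OF Rats_number_of])
    then show False using u_irrational by simp
  qed
  show "(1::int) \<noteq> 0" by simp
  \<comment> \<open>The polynomial is four times \<open>tau_eq\<close> after substituting
    \<open>\<tau> = \<alpha> / 2 - 1\<close> for the slope \<open>\<alpha>\<close>.\<close>
  show "of_int 1 * (2 / u)\<^sup>2 + of_int (- (24 * int c + 4)) * (2 / u) + of_int (44 * int c + 4) = 0"
  proof -
    have "of_int 1 * (2 / u)\<^sup>2 + of_int (- (24 * int c + 4)) * (2 / u) + of_int (44 * int c + 4) =
        4 * (\<tau>\<^sup>2 - (12 * real c * \<tau> + real c))"
      unfolding slope_eq by (simp add: power2_eq_square algebra_simps)
    then show ?thesis unfolding tau_eq by simp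
  qed
qed

end

theorem theorem6p7p2:
  "infinite {\<alpha> :: real. quadratic_irrational \<alpha> \<and>
     (\<exists>\<beta>>0. \<forall>\<gamma>. billiard_trajectory L_strip \<gamma> \<and> \<gamma> 0 \<in> L_strip_corners \<and> initial_slope \<gamma> \<alpha> \<longrightarrow>
        (\<forall>S\<in>L_strip_faces. \<exists>c\<^sub>0 :: nat. \<forall>n\<ge>c\<^sub>0. \<forall>Q\<in>S.
           \<exists>t\<in>{0..real n powr \<beta>}. dist (\<gamma> t) Q \<le> 1 / real n))}" (is "infinite ?A")
proof -
  \<comment> \<open>The positive root of \<open>tau_eq\<close>, strictly increasing in
    \<open>c\<close>, so that different \<open>c\<close> give different slopes.\<close>
  define \<tau> :: "nat \<Rightarrow> real" where "\<tau> c = 6 * real c + sqrt (36 * (real c)\<^sup>2 + real c)" for c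
  have root: "(6 * x + y)\<^sup>2 = 12 * x * (6 * x + y) + x" if "y\<^sup>2 = 36 * x\<^sup>2 + x" for x y :: real
  proof -
    have "(6 * x + y)\<^sup>2 - (12 * x * (6 * x + y) + x) = y\<^sup>2 - (36 * x\<^sup>2 + x)"
      by (simp add: power2_eq_square algebra_simps)
    with that show ?thesis by simp
  qed
  have slope: "strip_slope (Suc c) (\<tau> (Suc c))" for c
  proof
    show "\<tau> (Suc c) > 0" unfolding \<tau>_def by (intro add_pos_nonneg) auto
    have "(sqrt (36 * (real (Suc c))\<^sup>2 + real (Suc c)))\<^sup>2 = 36 * (real (Suc c))\<^sup>2 + real (Suc c)"
      by (rule real_sqrt_pow2) simp
    then show "(\<tau> (Suc c))\<^sup>2 = 12 * real (Suc c) * \<tau> (Suc c) + real (Suc c)"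
      using root unfolding \<tau>_def by blast
  qed simp
  have "2 * (1 + \<tau> (Suc c)) \<in> ?A" for c
  proof -
    interpret strip_slope "Suc c" "\<tau> (Suc c)" by (rule slope)
    show ?thesis using quadratic_irrational_slope slope_density unfolding slope_eq by blast
  qed
  then have sub: "range (\<lambda>c. 2 * (1 + \<tau> (Suc c))) \<subseteq> ?A" by blast
  have "strict_mono (\<lambda>c. 2 * (1 + \<tau> (Suc c)))"
  proof (rule strict_monoI)
    fix a b :: nat assume "a < b"
    then have "(real (Suc a))\<^sup>2 \<le> (real (Suc b))\<^sup>2" by (intro power_mono) auto
    then have "sqrt (36 * (real (Suc a))\<^sup>2 + real (Suc a)) \<le> sqrt (36 * (real (Suc b))\<^sup>2 + real (Suc b))"
      using \<open>a < b\<close> by (intro real_sqrt_le_mono add_mono mult_left_mono) auto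
    moreover have "6 * real (Suc a) < 6 * real (Suc b)" using \<open>a < b\<close> by simp
    ultimately have "\<tau> (Suc a) < \<tau> (Suc b)" unfolding \<tau>_def by (rule add_less_le_mono[rotated])
    then show "2 * (1 + \<tau> (Suc a)) < 2 * (1 + \<tau> (Suc b))" by simp
  qed
  then have "infinite (range (\<lambda>c. 2 * (1 + \<tau> (Suc c))))"
    by (intro range_inj_infinite strict_mono_imp_inj_on)
  then show ?thesis using sub by (rule infinite_super[rotated])
qed

end
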